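(* Let $p$ be a prime, let $G$ be a finite $p$-group, and let $n$ be a non-negative integer such that $|G'| > p^{n(n-1)/2}$. Then there do not exist $p-1$ proper subgroups $H_1, \dots, H_{p-1}$ of $G$ such that every element $x \in G$ with $b(x) \geq n$ lies in $H_1 \cup \dots \cup H_{p-1}$.
   Context: $G'$ denotes the derived subgroup of $G$. For $x$ in a finite $p$-group $G$, the breadth $b(x)$ is defined by $|G : C_G(x)| = p^{b(x)}$, where $C_G(x)$ is the centralizer of $x$ in $G$. *)

theory Defs
  imports "HOL-Algebra.Algebra"
begin

definition centralizer :: "('a, 'b) monoid_scheme \<Rightarrow> 'a \<Rightarrow> 'a set" where
  "centralizer G x = {g \<in> carrier G. g \<otimes>\<^bsub>G\<^esub> x = x \<otimes>\<^bsub>G\<^esub> g}"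

definition breadth :: "('a, 'b) monoid_scheme \<Rightarrow> nat \<Rightarrow> 'a \<Rightarrow> nat" where
  "breadth G p x = (THE b. card (rcosets\<^bsub>G\<^esub> (centralizer G x)) = p ^ b)"

definition p_group :: "('a, 'b) monoid_scheme \<Rightarrow> nat \<Rightarrow> bool" where
  "p_group G p \<longleftrightarrow> group G \<and> finite (carrier G) \<and> (\<exists>k. order G = p ^ k)"

end

theory Submission
  imports Defs "HOL-Library.Function_Algebras"
begin

text \<open>Write \<open>L\<close> for the graded Lie ring of the lower central series of \<open>G\<close>, let \<open>V = G/G'\<close> be its
  component of degree one, and suppose that all elements outside \<open>p - 1\<close> proper subgroups have
  breadth less than \<open>n\<close>. Then \<open>l \<mapsto> [l, x]\<close> has rank less than \<open>n\<close> on \<open>L\<close> for the image \<open>x\<close> in \<open>V\<close> of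
  any such element. We choose \<open>a\<^sub>1, a\<^sub>2, \<dots>\<close> in \<open>V\<close> such that \<open>l \<mapsto> [l, a\<^bsub>k+1\<^esub>]\<close> has rank less than
  \<open>n - k\<close> modulo \<open>A\<^sub>k = [L, a\<^sub>1] + \<dots> + [L, a\<^sub>k]\<close>, until \<open>A\<^sub>k = [L, L]\<close>. Then \<open>[L, L]\<close>, which has the
  same order as \<open>G'\<close>, has order at most \<open>p\<close> to the power \<open>(n - 1) + (n - 2) + \<dots> + 1\<close>.

  The rank drops for the following reason. If \<open>y\<close> has small rank modulo \<open>A\<^bsub>k-1\<^esub>\<close>, and some \<open>[l, y]\<close> lies in
  \<open>A\<^sub>k\<close> but not in \<open>A\<^bsub>k-1\<^esub>\<close>, then the rank of \<open>y\<close> modulo \<open>A\<^sub>k\<close> is smaller by one, and modulo \<open>A\<^sub>k\<close> the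
  rank only depends on the coset of \<open>y\<close> modulo \<open>a\<^sub>k\<close>. To produce such an \<open>l\<close> one uses bilinear forms
  \<open>(x, y) \<mapsto> [C x, y]\<close> on \<open>V\<close>, where \<open>C\<close> is built from commutation with the \<open>a\<^sub>i\<close>. By the Jacobi
  identity, reversing the word of the \<open>a\<^sub>i\<close> transposes the form modulo \<open>A\<^sub>k\<close>, so there are forms which are
  alternating or symmetric, and then \<open>[C a, y]\<close> lies in \<open>[L, a]\<close> modulo \<open>A\<^sub>k\<close>.\<close>

section \<open>Additive subgroups\<close>

definition add_sub :: "'l::ab_group_add set \<Rightarrow> bool" where
  "add_sub S \<longleftrightarrow> 0 \<in> S \<and> (\<forall>x\<in>S. \<forall>y\<in>S. x - y \<in> S)"

lemma add_sub_zero: "add_sub S \<Longrightarrow> 0 \<in> S"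
  by (simp add: add_sub_def)

lemma add_sub_diff: "add_sub S \<Longrightarrow> x \<in> S \<Longrightarrow> y \<in> S \<Longrightarrow> x - y \<in> S"
  by (simp add: add_sub_def)

lemma add_sub_uminus: "add_sub S \<Longrightarrow> x \<in> S \<Longrightarrow> - x \<in> S"
  by (metis add_sub_diff add_sub_zero diff_0)

lemma add_sub_add: "add_sub S \<Longrightarrow> x \<in> S \<Longrightarrow> y \<in> S \<Longrightarrow> x + y \<in> S"
  by (metis add_sub_diff add_sub_uminus diff_minus_eq_add)

lemma add_sub_add_iff: "add_sub S \<Longrightarrow> x \<in> S \<Longrightarrow> x + y \<in> S \<longleftrightarrow> y \<in> S"
  by (metis add_sub_add add_sub_diff add_diff_cancel_left')

lemma add_sub_add_iff': "add_sub S \<Longrightarrow> y \<in> S \<Longrightarrow> x + y \<in> S \<longleftrightarrow> x \<in> S"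
  by (metis add_sub_add_iff add.commute)

lemma add_sub_diff_iff: "add_sub S \<Longrightarrow> x - y \<in> S \<Longrightarrow> x \<in> S \<longleftrightarrow> y \<in> S"
  by (metis add_sub_add_iff diff_add_cancel)

lemma add_sub_sum_iff: "add_sub S \<Longrightarrow> x + y \<in> S \<Longrightarrow> x \<in> S \<longleftrightarrow> y \<in> S"
  by (metis add_sub_add_iff add_sub_add_iff')

lemma add_sub_not_Un:
  assumes "add_sub V" "add_sub H" "add_sub K" "\<exists>v\<in>V. v \<notin> H" "\<exists>v\<in>V. v \<notin> K"
  shows "\<exists>v\<in>V. v \<notin> H \<and> v \<notin> K"
proof (rule ccontr)
  assume *: "\<not> ?thesis"
  obtain x y where x: "x \<in> V" "x \<notin> H" and y: "y \<in> V" "y \<notin> K" using assms by auto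
  then have "x \<in> K" "y \<in> H" using * by auto
  then have "x + y \<notin> H" "x + y \<notin> K" using x y assms add_sub_add_iff add_sub_add_iff' by metis+
  then show False using * x y add_sub_add assms(1) by blast
qed

inductive_set aspan :: "'l::ab_group_add set \<Rightarrow> 'l set" for S where
  zero: "0 \<in> aspan S"
| base: "x \<in> S \<Longrightarrow> x \<in> aspan S"
| diff: "x \<in> aspan S \<Longrightarrow> y \<in> aspan S \<Longrightarrow> x - y \<in> aspan S"

lemma add_sub_aspan: "add_sub (aspan S)"
  by (simp add: add_sub_def aspan.zero aspan.diff)

lemma aspan_least: "add_sub T \<Longrightarrow> S \<subseteq> T \<Longrightarrow> aspan S \<subseteq> T"
proof
  fix x assume "add_sub T" "S \<subseteq> T" "x \<in> aspan S"
  from this(3) show "x \<in> T"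
    by induction (use \<open>add_sub T\<close> \<open>S \<subseteq> T\<close> in \<open>auto simp: add_sub_def\<close>)
qed

section \<open>Graded Lie rings\<close>

text \<open>The index is shifted by one: \<open>L d\<close> is the component of degree \<open>d + 1\<close>, and
  the graded Lie ring itself is \<open>L / N\<close>.\<close>

locale graded_lie =
  fixes L N :: "nat \<Rightarrow> 'l::ab_group_add set" and br :: "'l \<Rightarrow> 'l \<Rightarrow> 'l"
  assumes sub_L: "add_sub (L d)"
    and sub_N: "add_sub (N d)"
    and N_le_L: "N d \<subseteq> L d"
    and br_add_left: "br (x + y) z = br x z + br y z"
    and br_add_right: "br z (x + y) = br z x + br z y"
    and br_L: "x \<in> L i \<Longrightarrow> y \<in> L j \<Longrightarrow> br x y \<in> L (Suc (i + j))"
    and br_N_left: "x \<in> N i \<Longrightarrow> y \<in> L j \<Longrightarrow> br x y \<in> N (Suc (i + j))"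
    and antisym: "x \<in> L i \<Longrightarrow> y \<in> L j \<Longrightarrow> br x y + br y x \<in> N (Suc (i + j))"
    and alt: "x \<in> L 0 \<Longrightarrow> br x x \<in> N 1"
    and jacobi: "m \<in> L i \<Longrightarrow> a \<in> L 0 \<Longrightarrow> x \<in> L j \<Longrightarrow>
      br (br m a) x - br m (br a x) - br (br m x) a \<in> N (Suc (Suc (i + j)))"
    and generated: "add_sub S \<Longrightarrow> N (Suc d) \<subseteq> S \<Longrightarrow>
      (\<And>l x. l \<in> L d \<Longrightarrow> x \<in> L 0 \<Longrightarrow> br l x \<in> S) \<Longrightarrow> L (Suc d) \<subseteq> S"
begin

lemma br_zero_left [simp]: "br 0 x = 0"
  using br_add_left[of 0 0 x] by simp

lemma br_zero_right [simp]: "br x 0 = 0"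
  using br_add_right[of x 0 0] by simp

lemma br_minus_left: "br (- x) y = - br x y"
  using br_add_left[of x "- x" y] by (simp add: minus_unique)

lemma br_minus_right: "br x (- y) = - br x y"
  using br_add_right[of x y "- y"] by (simp add: minus_unique)

lemma br_diff_left: "br (x - y) z = br x z - br y z"
  using br_add_left[of x "- y" z] by (simp add: br_minus_left)

lemma br_diff_right: "br z (x - y) = br z x - br z y"
  using br_add_right[of z x "- y"] by (simp add: br_minus_right)

lemma br_N_right: "x \<in> L i \<Longrightarrow> y \<in> N j \<Longrightarrow> br x y \<in> N (Suc (i + j))"
  using antisym[of x i y j] br_N_left[of y j x i] N_le_L[of j] sub_N add_sub_sum_iff
  by (metis add.commute subsetD)

text \<open>\<open>A [a\<^sub>k, \<dots>, a\<^sub>1] d\<close> is the sum of the \<open>[L d, a\<^sub>i]\<close>, a subgroup of \<open>L (Suc d)\<close>.\<close>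

primrec A :: "'l list \<Rightarrow> nat \<Rightarrow> 'l set" where
  "A [] d = N (Suc d)"
| "A (a # as) d = {z + br l a |z l. z \<in> A as d \<and> l \<in> L d}"

lemma A_ConsI: "z \<in> A as d \<Longrightarrow> l \<in> L d \<Longrightarrow> z + br l a \<in> A (a # as) d"
  by auto

lemma sub_A: "add_sub (A as d)"
proof (induction as)
  case (Cons a as)
  show ?case unfolding add_sub_def
  proof (intro conjI ballI)
    show "0 \<in> A (a # as) d"
      using A_ConsI[OF add_sub_zero[OF Cons] add_sub_zero[OF sub_L]] by simp
    fix x y assume "x \<in> A (a # as) d" "y \<in> A (a # as) d"
    then obtain z l z' l' where *: "x = z + br l a" "y = z' + br l' a"
      "z \<in> A as d" "z' \<in> A as d" "l \<in> L d" "l' \<in> L d" by auto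
    then have "(z - z') + br (l - l') a \<in> A (a # as) d"
      by (intro A_ConsI add_sub_diff[OF Cons] add_sub_diff[OF sub_L])
    then show "x - y \<in> A (a # as) d" using * by (simp add: br_diff_left algebra_simps)
  qed
qed (simp add: sub_N)

lemma A_mono: "A as d \<subseteq> A (a # as) d"
proof
  fix z assume "z \<in> A as d"
  then have "z + br 0 a \<in> A (a # as) d" by (rule A_ConsI[OF _ add_sub_zero[OF sub_L]])
  moreover have "z + br 0 a = z" by simp
  ultimately show "z \<in> A (a # as) d" by metis
qed

lemma A_append_mono: "A bs d \<subseteq> A (cs @ bs) d"
proof (induction cs)
  case (Cons c cs)
  then show ?case using A_mono[of "cs @ bs" d c] by (metis append_Cons subset_trans)
qed simp

lemma N_le_A: "N (Suc d) \<subseteq> A as d"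
  using A_append_mono[where bs = "[]" and cs = as] by simp

lemma A_le_L: "set as \<subseteq> L 0 \<Longrightarrow> A as d \<subseteq> L (Suc d)"
proof (induction as)
  case (Cons a as)
  then show ?case using br_L[of _ d a 0] add_sub_add[OF sub_L] by fastforce
qed (simp add: N_le_L)

lemma br_mem_A: "a \<in> set as \<Longrightarrow> l \<in> L d \<Longrightarrow> br l a \<in> A as d"
proof (induction as)
  case (Cons b as)
  show ?case
  proof (cases "a = b")
    case True
    then show ?thesis using A_ConsI[OF add_sub_zero[OF sub_A] Cons.prems(2), where as = as and a = b] by simp
  next
    case False
    then show ?thesis using Cons A_mono[of as d b] by auto
  qed
qed simp

section \<open>Left-normed brackets with words\<close>

lemma foldl_br_add: "foldl br (x + y) w = foldl br x w + foldl br y w"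
  by (induction w arbitrary: x y) (simp_all add: br_add_left)

lemma foldl_br_L: "set w \<subseteq> L 0 \<Longrightarrow> x \<in> L d \<Longrightarrow> foldl br x w \<in> L (d + length w)"
proof (induction w arbitrary: x d)
  case (Cons b w)
  have "br x b \<in> L (Suc d)" using br_L[of x d b 0] Cons.prems by simp
  then show ?case using Cons.IH[of "br x b" "Suc d"] Cons.prems by simp
qed simp

lemma foldl_br_N: "set w \<subseteq> L 0 \<Longrightarrow> x \<in> N d \<Longrightarrow> foldl br x w \<in> N (d + length w)"
proof (induction w arbitrary: x d)
  case (Cons b w)
  have "br x b \<in> N (Suc d)" using br_N_left[of x d b 0] Cons.prems by simp
  then show ?case using Cons.IH[of "br x b" "Suc d"] Cons.prems by simp
qed simp

text \<open>The sign picked up when a word of length \<open>n\<close> is carried across the bracket,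
  one factor -1 per letter.\<close>

definition flip :: "nat \<Rightarrow> 'l \<Rightarrow> 'l" where
  "flip n x = (if even n then x else - x)"

text \<open>Moving the letters of a word one at a time to the right-hand side of the bracket: the
  error terms of the Jacobi identity all lie in \<open>[L, as]\<close>.\<close>

lemma word_shift:
  assumes "set as \<subseteq> L 0" "set w \<subseteq> set as" "m \<in> L i" "z \<in> L j"
  shows "br (foldl br m w) z - flip (length w) (br m (foldl br z (rev w)))
    \<in> A as (i + j + length w)"
  using assms(2-4)
proof (induction w arbitrary: z j rule: rev_induct)
  case Nil
  then show ?case using add_sub_zero[OF sub_A] by (simp add: flip_def)
next
  case (snoc b w)
  let ?M = "foldl br m w" and ?d = "i + j + Suc (length w)"
  have b: "b \<in> L 0" using snoc.prems assms(1) by auto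
  have wL: "set w \<subseteq> L 0" using snoc.prems assms(1) by auto
  have M: "?M \<in> L (i + length w)" using foldl_br_L[OF wL snoc.prems(2)] .
  have zb: "br z b \<in> L (Suc j)" using br_L[OF snoc.prems(3) b] by simp
  have IH: "br ?M (br z b) - flip (length w) (br m (foldl br (br z b) (rev w))) \<in> A as ?d"
    using snoc.IH[of "br z b" "Suc j"] snoc.prems zb by simp
  have eq1: "Suc (i + length w + j) = ?d" by simp
  have 1: "br (br ?M b) z - br ?M (br b z) - br (br ?M z) b \<in> A as ?d"
    using jacobi[OF M b snoc.prems(3)] N_le_A[of ?d as] eq1 by auto
  have 2: "br (br ?M z) b \<in> A as ?d"
    using br_mem_A[of b as "br ?M z" "Suc (i + length w + j)"] snoc.prems br_L[OF M snoc.prems(3)]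
      eq1 by simp
  have "br b z + br z b \<in> N (Suc j)"
    using antisym[OF b snoc.prems(3)] by simp
  from br_N_right[OF M this] have "br ?M (br b z + br z b) \<in> N (Suc ?d)"
    by (simp add: ac_simps)
  then have 3: "br ?M (br b z) + br ?M (br z b) \<in> A as ?d"
    using N_le_A[of ?d as] by (auto simp: br_add_right)
  have "br (br ?M b) z - flip (Suc (length w)) (br m (foldl br (br z b) (rev w)))
    = (br (br ?M b) z - br ?M (br b z) - br (br ?M z) b) + br (br ?M z) b
      + (br ?M (br b z) + br ?M (br z b))
      - (br ?M (br z b) - flip (length w) (br m (foldl br (br z b) (rev w))))"
    by (simp add: flip_def)
  also have "\<dots> \<in> A as ?d"
    by (intro add_sub_diff[OF sub_A] add_sub_add[OF sub_A] 1 2 3 IH)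
  finally show ?case by simp
qed

text \<open>All letters are carried across by \<open>word_shift\<close>, then the two entries are
  swapped. Up to sign, the forms of a word and of its reverse are thus transposes of each other
  modulo \<open>A as\<close>.\<close>

lemma word_reverse:
  assumes "set as \<subseteq> L 0" "set w \<subseteq> set as" "x \<in> L 0" "y \<in> L 0"
  shows "br (foldl br y w) x + flip (length w) (br (foldl br x (rev w)) y) \<in> A as (length w)"
proof -
  let ?u = "br y (foldl br x (rev w))" and ?v = "br (foldl br x (rev w)) y"
  have 1: "br (foldl br y w) x - flip (length w) ?u \<in> A as (length w)"
    using word_shift[OF assms(1,2,4,3)] by simp
  have "foldl br x (rev w) \<in> L (length w)"
    using foldl_br_L[of "rev w" x 0] assms by auto
  then have "?u + ?v \<in> N (Suc (length w))"
    using antisym[of y 0 "foldl br x (rev w)" "length w"] assms(4) by simp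
  then have 2: "?u + ?v \<in> A as (length w)" using N_le_A by auto
  then have "flip (length w) ?u + flip (length w) ?v \<in> A as (length w)"
    using add_sub_uminus[OF sub_A 2] by (auto simp: flip_def)
  from add_sub_add[OF sub_A 1 this] show ?thesis by simp
qed

text \<open>Nothing of degree two is left outside \<open>[L, as]\<close>. Until this happens,
  isotropic steps use the plain bracket on \<open>L 0\<close> as their form.\<close>

definition exhausted :: "'l list \<Rightarrow> bool" where
  "exhausted as \<longleftrightarrow> (\<forall>x\<in>L 0. \<forall>y\<in>L 0. br x y \<in> A as 0)"

lemma exhausted_mono: "exhausted as \<Longrightarrow> exhausted (a # as)"
  unfolding exhausted_def using A_mono by blast

text \<open>One induction gives both claims: if \<open>L d\<close> is spanned by words, whose
  brackets with \<open>L 0\<close> lie in \<open>A as d\<close>, then \<open>L (Suc d)\<close> is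
  contained in \<open>A as d\<close>, and this is spanned by words with one more letter. Conversely,
  as long as \<open>A as\<close> is not everything, some word or the bracket itself gives a nonzero
  form.\<close>

lemma L_spanned_by_words:
  assumes as: "set as \<subseteq> L 0"
    and zero: "\<And>w x y. set w \<subseteq> set as \<Longrightarrow> x \<in> L 0 \<Longrightarrow> y \<in> L 0 \<Longrightarrow>
      br (foldl br y w) x \<in> A as (length w)"
  shows "L d \<subseteq> aspan ({foldl br y w |y w. y \<in> L 0 \<and> set w \<subseteq> set as \<and> length w = d} \<union> N d)
    \<and> L (Suc d) \<subseteq> A as d" (is "L d \<subseteq> aspan (?W d) \<and> _")
proof (induction d)
  have key: "L (Suc d) \<subseteq> A as d" if "L d \<subseteq> aspan (?W d)" for d
  proof (rule generated[OF sub_A N_le_A])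
    fix l x assume l: "l \<in> L d" and x: "x \<in> L 0"
    have "add_sub {l. br l x \<in> A as d}"
      using sub_A by (auto simp: add_sub_def br_diff_left)
    moreover have "?W d \<subseteq> {l. br l x \<in> A as d}"
      using zero x br_N_left[of _ d x 0] N_le_A[of d as] by auto
    ultimately show "br l x \<in> A as d"
      using aspan_least[of "{l. br l x \<in> A as d}" "?W d"] that l by auto
  qed
  {
    case 0
    have "y \<in> ?W 0" if "y \<in> L 0" for y using that by (auto intro!: exI[of _ y] exI[of _ "[]"])
    then have "L 0 \<subseteq> aspan (?W 0)" using aspan.base by blast
    then show ?case using key[of 0] by blast
  next
    case (Suc d)
    have *: "br l b \<in> aspan (?W (Suc d))" if "l \<in> L d" "b \<in> set as" for l b
    proof -
      have "add_sub {l. br l b \<in> aspan (?W (Suc d))}"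
        using add_sub_aspan[of "?W (Suc d)"] by (simp add: add_sub_def br_diff_left)
      moreover have "?W d \<subseteq> {l. br l b \<in> aspan (?W (Suc d))}"
      proof
        fix l assume "l \<in> ?W d"
        then consider y w where "l = foldl br y w" "y \<in> L 0" "set w \<subseteq> set as" "length w = d" | "l \<in> N d"
          by auto
        then have "br l b \<in> ?W (Suc d)"
        proof cases
          case 1
          then show ?thesis using that(2) by (auto intro!: exI[of _ y] exI[of _ "w @ [b]"])
        next
          case 2
          then show ?thesis using br_N_left[of l d b 0] that(2) as by auto
        qed
        then show "l \<in> {l. br l b \<in> aspan (?W (Suc d))}" by (simp add: aspan.base)
      qed
      ultimately show ?thesis
        using aspan_least[of "{l. br l b \<in> aspan (?W (Suc d))}" "?W d"] Suc that(1) by blast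
    qed
    have "A bs d \<subseteq> aspan (?W (Suc d))" if "set bs \<subseteq> set as" for bs
      using that
    proof (induction bs)
      case Nil
      then show ?case by (auto intro: aspan.base)
    next
      case (Cons b bs)
      then show ?case using * add_sub_add[OF add_sub_aspan] by fastforce
    qed
    then have "L (Suc d) \<subseteq> aspan (?W (Suc d))" using Suc by blast
    then show ?case using key by blast
  }
qed

text \<open>Lists of letters grow at the front, so \<open>cs\<close> holds the letters chosen before
  \<open>b\<close>: the lemma locates a letter whose arrival destroys \<open>P\<close>.\<close>

lemma last_nonzero_suffix:
  assumes "\<not> P as" "P []"
  obtains b cs ds where "as = ds @ b # cs" "P cs" "\<not> P (b # cs)"
proof -
  have "\<exists>ds b cs. as = ds @ b # cs \<and> P cs \<and> \<not> P (b # cs)"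
    using assms(1)
  proof (induction as)
    case (Cons a as)
    show ?case
    proof (cases "P as")
      case True
      then show ?thesis using Cons.prems by (metis append_Nil)
    next
      case False
      then show ?thesis using Cons.IH by (metis append_Cons)
    qed
  qed (use assms in simp)
  then show ?thesis using that by blast
qed

section \<open>Bilinear forms on the component of degree one\<close>

text \<open>The map \<open>C\<close> stands for the bilinear form
  \<open>(x, y) \<mapsto> br (C x) y\<close> with values in \<open>L (Suc d)\<close> modulo
  \<open>A as d\<close>.\<close>

definition lin :: "('l \<Rightarrow> 'l) \<Rightarrow> nat \<Rightarrow> bool" where
  "lin C d \<longleftrightarrow> (\<forall>x\<in>L 0. C x \<in> L d) \<and> (\<forall>x y. C (x + y) = C x + C y)"

lemma lin_diff: "lin C d \<Longrightarrow> C (x - y) = C x - C y"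
  unfolding lin_def by (metis add_diff_cancel diff_add_cancel)

definition alternating :: "'l list \<Rightarrow> ('l \<Rightarrow> 'l) \<Rightarrow> nat \<Rightarrow> bool" where
  "alternating as C d \<longleftrightarrow> (\<forall>x\<in>L 0. br (C x) x \<in> A as d)"

definition nonzero :: "'l list \<Rightarrow> ('l \<Rightarrow> 'l) \<Rightarrow> nat \<Rightarrow> bool" where
  "nonzero as C d \<longleftrightarrow> (\<exists>x\<in>L 0. \<exists>y\<in>L 0. br (C x) y \<notin> A as d)"

definition symmetric :: "'l list \<Rightarrow> ('l \<Rightarrow> 'l) \<Rightarrow> nat \<Rightarrow> bool" where
  "symmetric as C d \<longleftrightarrow> (\<forall>x\<in>L 0. \<forall>y\<in>L 0. br (C x) y - br (C y) x \<in> A as d)"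

text \<open>An \<open>x\<close> in \<open>L 0\<close> outside such a \<open>K\<close> has a nonzero
  bracket with some letter \<open>b\<close> modulo the letters \<open>cs\<close> before it, at a
  time when degree two was not yet exhausted. The kernels of the symmetric forms in
  \<open>exists_form\<close> are of this kind.\<close>

definition avoiders :: "'l list \<Rightarrow> 'l set set" where
  "avoiders as = {K. add_sub K \<and> set as \<subseteq> K \<and>
    (\<exists>ds b cs. as = ds @ b # cs \<and> \<not> exhausted cs \<and> {y\<in>L 0. br y b \<in> A cs 0} \<subseteq> K)}"

lemma alternating_antisym:
  assumes "lin C d" "alternating as C d" "x \<in> L 0" "y \<in> L 0"
  shows "br (C x) y + br (C y) x \<in> A as d"
proof -
  have "br (C (x + y)) (x + y) - br (C x) x - br (C y) y \<in> A as d"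
    using assms(2-4) add_sub_add[OF sub_L] by (intro add_sub_diff[OF sub_A]) (auto simp: alternating_def)
  moreover have "br (C (x + y)) (x + y) - br (C x) x - br (C y) y = br (C x) y + br (C y) x"
    using assms(1) by (simp add: lin_def br_add_left br_add_right)
  ultimately show ?thesis by simp
qed

lemma alternating_mono: "alternating as C d \<Longrightarrow> alternating (a # as) C d"
  unfolding alternating_def using A_mono by blast

text \<open>Some word gives a nonzero form, since otherwise \<open>L_spanned_by_words\<close> would
  make \<open>A as\<close> everything. If this form is not symmetric, its difference with its
  transpose is alternating and nonzero. If it is symmetric, its kernels are controlled by the first
  letter of the word, which is taken as early as possible.\<close>

lemma exists_form:
  assumes as: "set as \<subseteq> L 0" and exh: "exhausted as" and nf: "\<exists>d. A as d \<noteq> L (Suc d)"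
  shows "\<exists>C d. lin C d \<and> nonzero as C d \<and>
    (alternating as C d \<or>
     symmetric as C d \<and> (\<forall>z\<in>L 0. {x\<in>L 0. br (C z) x \<in> A as d} \<in> avoiders as))"
proof -
  \<comment> \<open>Vanishing is recorded by the first letter of a word, so that the nonzero word
    \<open>b # w\<close> found below has the property that all words beginning with an earlier
    letter vanish.\<close>
  define Z where "Z bs \<longleftrightarrow> (\<forall>b w x y. b \<in> set bs \<longrightarrow> set (b # w) \<subseteq> set as \<longrightarrow> x \<in> L 0 \<longrightarrow> y \<in> L 0
    \<longrightarrow> br (foldl br y (b # w)) x \<in> A as (length (b # w)))" for bs
  have "\<not> Z as"
  proof
    assume Z: "Z as"
    have "br (foldl br y w) x \<in> A as (length w)"
      if "set w \<subseteq> set as" "x \<in> L 0" "y \<in> L 0" for w x y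
    proof (cases w)
      case Nil
      then show ?thesis using exh that by (simp add: exhausted_def)
    next
      case (Cons b v)
      then show ?thesis using Z that unfolding Z_def by (metis list.set_intros(1) subsetD)
    qed
    then have "L (Suc d) \<subseteq> A as d" for d using L_spanned_by_words[OF as] by blast
    then show False using nf A_le_L[OF as] by blast
  qed
  moreover have "Z []" by (simp add: Z_def)
  ultimately obtain ds b cs where suf: "as = ds @ b # cs" "Z cs" "\<not> Z (b # cs)"
    by (rule last_nonzero_suffix)
  then obtain w x0 y0 where w: "set (b # w) \<subseteq> set as" "x0 \<in> L 0" "y0 \<in> L 0"
    "br (foldl br y0 (b # w)) x0 \<notin> A as (length (b # w))"
    unfolding Z_def by fastforce
  let ?w = "b # w" and ?d = "length (b # w)"
  let ?C = "\<lambda>y. foldl br y (b # w)"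
  have wL: "set ?w \<subseteq> L 0" using w(1) as by auto
  have linC: "lin ?C ?d"
    unfolding lin_def using foldl_br_L[OF wL, of _ 0] foldl_br_add[of _ _ ?w] by simp
  \<comment> \<open>Modulo \<open>N\<close>, an element of \<open>A es 0\<close> is a sum of
    brackets \<open>br l c\<close> with \<open>c\<close> earlier than \<open>b\<close>. Applying
    \<open>w\<close> to it gives words beginning with \<open>c\<close>, which vanish by
    \<open>Z cs\<close>.\<close>
  have low: "br (foldl br z w) x \<in> A as ?d" if "z \<in> A es 0" "set es \<subseteq> set cs" "x \<in> L 0" for z x es
    using that
  proof (induction es arbitrary: z)
    case Nil
    then have "foldl br z w \<in> N (Suc (length w))" using foldl_br_N[of w z 1] wL by simp
    then have "br (foldl br z w) x \<in> N (Suc ?d)" using br_N_left[of _ _ x 0] Nil by fastforce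
    then show ?case using N_le_A by blast
  next
    case (Cons c es)
    then obtain z' l where z: "z = z' + br l c" "z' \<in> A es 0" "l \<in> L 0" by auto
    have "set (c # w) \<subseteq> set as" using Cons.prems suf(1) w(1) by auto
    then have "br (foldl br l (c # w)) x \<in> A as (length (c # w))"
      using suf(2) z(3) Cons.prems unfolding Z_def by (metis list.set_intros(1) subsetD)
    moreover have "br (foldl br z' w) x \<in> A as ?d" using Cons z by auto
    ultimately show ?case using add_sub_add[OF sub_A]
      by (simp add: z(1) foldl_br_add br_add_left)
  qed
  have kill: "br (?C y) x \<in> A as ?d" if "br y b \<in> A cs 0" "x \<in> L 0" for x y
    using low[OF that(1) _ that(2)] by simp
  have nexh: "\<not> exhausted cs"
  proof
    assume "exhausted cs"
    then have "br y0 b \<in> A cs 0" using w wL by (auto simp: exhausted_def)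
    then show False using kill w by blast
  qed
  show ?thesis
  proof (cases "symmetric as ?C ?d")
    case True
    have "{x\<in>L 0. br (?C z) x \<in> A as ?d} \<in> avoiders as" if z: "z \<in> L 0" for z
    proof -
      let ?K = "{x\<in>L 0. br (?C z) x \<in> A as ?d}"
      have "add_sub ?K"
        using sub_A[of as ?d] sub_L[of 0] by (auto simp: add_sub_def br_diff_right)
      moreover have "set as \<subseteq> ?K"
        using as br_mem_A[of _ as "?C z" ?d] linC z by (auto simp: lin_def)
      \<comment> \<open>Such a \<open>y\<close> is killed in the first entry because the word begins
        with \<open>b\<close>; symmetry moves it to the second entry.\<close>
      moreover have "{y\<in>L 0. br y b \<in> A cs 0} \<subseteq> ?K"
      proof
        fix y assume y: "y \<in> {y\<in>L 0. br y b \<in> A cs 0}"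
        then have "br (?C y) z \<in> A as ?d" using kill z by blast
        moreover have "br (?C z) y - br (?C y) z \<in> A as ?d"
          using True y z unfolding symmetric_def by blast
        ultimately show "y \<in> ?K" using y add_sub_diff_iff[OF sub_A] by blast
      qed
      ultimately show ?thesis using suf(1) nexh unfolding avoiders_def by blast
    qed
    then show ?thesis using True linC w unfolding nonzero_def by blast
  next
    case False
    \<comment> \<open>By \<open>word_reverse\<close>, \<open>?R\<close> represents minus the
      transpose of the form of \<open>?C\<close>, so \<open>?D\<close> represents the form minus its
      transpose.\<close>
    let ?R = "\<lambda>y. flip ?d (foldl br y (rev ?w))"
    let ?D = "\<lambda>y. ?C y + ?R y"
    have flip_br: "br (flip n u) v = flip n (br u v)" for n u v
      by (simp add: flip_def br_minus_left)
    have flip_add: "flip n (u + v) = flip n u + flip n v" for n u v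
      by (simp add: flip_def)
    have rL: "set (rev ?w) \<subseteq> L 0" using wL by auto
    have flip_L: "flip n u \<in> L e" if "u \<in> L e" for n u e
      using that add_sub_uminus[OF sub_L] by (simp add: flip_def)
    have "foldl br y (rev ?w) \<in> L ?d" if "y \<in> L 0" for y
      using foldl_br_L[OF rL that] by (simp only: length_rev add_0)
    then have linD: "lin ?D ?d"
      using linC flip_L add_sub_add[OF sub_L] unfolding lin_def
      by (simp only: foldl_br_add flip_add) (simp add: algebra_simps)
    have rel: "br (?C y) x + br (?R x) y \<in> A as ?d" if "x \<in> L 0" "y \<in> L 0" for x y
      using word_reverse[OF as w(1) that] by (simp only: flip_br)
    have "alternating as ?D ?d"
      unfolding alternating_def using rel by (simp only: br_add_left) blast
    moreover have "nonzero as ?D ?d"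
    proof -
      from False obtain x y where xy: "x \<in> L 0" "y \<in> L 0" "br (?C x) y - br (?C y) x \<notin> A as ?d"
        unfolding symmetric_def by blast
      have "br (?D x) y = (br (?C x) y - br (?C y) x) + (br (?C y) x + br (?R x) y)"
        by (simp only: br_add_left) simp
      then have "br (?D x) y \<notin> A as ?d"
        using xy rel[OF xy(1,2)] add_sub_add_iff'[OF sub_A] by metis
      then show ?thesis using xy unfolding nonzero_def by blast
    qed
    ultimately show ?thesis using linD by blast
  qed
qed

declare A.simps(2) [simp del]

end

section \<open>Elements of small rank\<close>

text \<open>This isolates what the choice of the letters needs from the group. \<open>U\<close>
  stands for the classes of the elements outside the given subgroups, and \<open>good as x\<close>
  for a bound on the rank of \<open>x\<close> modulo \<open>A as\<close> that drops with every
  letter; \<open>good_Cons\<close> is this drop.\<close>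

locale good_elements = graded_lie L N br
  for L N :: "nat \<Rightarrow> 'l::ab_group_add set" and br :: "'l \<Rightarrow> 'l \<Rightarrow> 'l" +
  fixes good :: "'l list \<Rightarrow> 'l \<Rightarrow> bool" and U :: "'l set"
  assumes U_le_L: "U \<subseteq> L 0"
    and good_Nil: "x \<in> U \<Longrightarrow> good [] x"
    and U_not_le: "add_sub K \<Longrightarrow> N 0 \<subseteq> K \<Longrightarrow> \<exists>x\<in>L 0. x \<notin> K \<Longrightarrow> \<exists>x\<in>U. x \<notin> K"
    and U_translate: "a \<in> U \<Longrightarrow> x \<in> L 0 \<Longrightarrow> \<exists>y\<in>U. x - y \<in> aspan {a}"
    and good_Cons: "set as \<subseteq> L 0 \<Longrightarrow> a \<in> L 0 \<Longrightarrow> x \<in> L 0 \<Longrightarrow> y \<in> L 0 \<Longrightarrow> good as y \<Longrightarrow>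
      l \<in> L d \<Longrightarrow> br l y \<in> A (a # as) d \<Longrightarrow> br l y \<notin> A as d \<Longrightarrow>
      x - y \<in> aspan {a} \<Longrightarrow> good (a # as) x"
begin

text \<open>The letter \<open>a\<close> was chosen by means of the alternating form \<open>(x, y) \<mapsto> [C x, y]\<close>. The clause on
  \<open>avoiders\<close> covers elements \<open>x\<close> orthogonal to \<open>a\<close>: then \<open>[C e, x]\<close> replaces \<open>[C a, x]\<close> as a
  bracket in \<open>A (a # bs)\<close> outside \<open>A bs\<close>, after adding a multiple of \<open>a\<close> to \<open>x\<close>. It is needed for
  \<open>p = 2\<close>, where this multiple cannot be chosen to satisfy a further condition.\<close>

definition isotropic_step :: "'l \<Rightarrow> 'l list \<Rightarrow> ('l \<Rightarrow> 'l) \<Rightarrow> nat \<Rightarrow> bool" where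
  "isotropic_step a bs C d \<longleftrightarrow> lin C d \<and> alternating bs C d \<and>
    (\<exists>e\<in>L 0. br (C a) e \<notin> A bs d) \<and>
    (\<forall>x\<in>L 0. br (C a) x \<notin> A bs d \<longrightarrow> good (a # bs) x) \<and>
    (\<forall>K\<in>avoiders (a # bs). \<forall>x\<in>L 0. \<forall>e\<in>L 0.
      x \<notin> K \<longrightarrow> br (C a) e \<notin> A bs d \<longrightarrow> br (C e) x \<in> A (a # bs) d \<longrightarrow> good (a # bs) x) \<and>
    (\<not> exhausted (a # bs) \<longrightarrow> d = 0 \<and> C = (\<lambda>x. x))"

definition all_good :: "'l list \<Rightarrow> bool" where
  "all_good as \<longleftrightarrow> exhausted as \<and> (\<forall>x\<in>L 0. good as x)"

text \<open>The invariant of the construction: unless all elements are good, the good ones are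
  controlled by the form used for the last letter.\<close>

definition extendible :: "'l list \<Rightarrow> bool" where
  "extendible as \<longleftrightarrow> set as \<subseteq> L 0 \<and>
    (all_good as \<or> (\<exists>a bs C d. as = a # bs \<and> isotropic_step a bs C d))"

lemma kernel_sub: "add_sub {x\<in>L 0. br u x \<in> A as d}"
  using sub_A[of as d] sub_L[of 0] by (auto simp: add_sub_def br_diff_right)

lemma radical_sub: "lin C d \<Longrightarrow> add_sub {x\<in>L 0. \<forall>y\<in>L 0. br (C x) y \<in> A as d}"
  using sub_A[of as d] sub_L[of 0] lin_diff[of C d]
  by (auto simp: add_sub_def br_diff_left) (metis br_zero_left diff_self)

text \<open>Only the shifts by 0 and by \<open>a\<close> are used, so the argument works for every
  prime, but it escapes from one subgroup at a time.\<close>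

lemma translate_out:
  assumes "add_sub V" "add_sub H" "a \<in> V" "x \<in> V" "a \<notin> H \<or> x \<notin> H"
  obtains y where "y \<in> V" "y \<notin> H" "y = x \<or> y = x + a"
  using assms add_sub_add add_sub_add_iff by metis

lemma translate_aspan: "y = x \<or> y = x + a \<Longrightarrow> x - y \<in> aspan {a}"
  using aspan.base[of a "{a}"] aspan.zero add_sub_uminus[OF add_sub_aspan] by auto

lemma alternating_br_iff:
  assumes "lin C d" "alternating as C d" "x \<in> L 0" "y \<in> L 0"
  shows "br (C x) y \<in> A as d \<longleftrightarrow> br (C y) x \<in> A as d"
  using alternating_antisym[OF assms] add_sub_sum_iff[OF sub_A] by blast

lemma alternating_mem_Cons:
  assumes "lin C d" "alternating as C d" "x \<in> L 0" "a \<in> L 0"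
  shows "br (C a) x \<in> A (a # as) d"
proof -
  have "br (C a) x + br (C x) a \<in> A (a # as) d"
    using alternating_antisym[OF assms(1,2,4,3)] A_mono by blast
  moreover have "br (C x) a \<in> A (a # as) d" using assms by (intro br_mem_A) (auto simp: lin_def)
  ultimately show ?thesis using add_sub_sum_iff[OF sub_A] by blast
qed

lemma avoiders_Cons:
  assumes "K \<in> avoiders (a # as)"
  shows "a \<in> K" "add_sub K"
    "K \<in> avoiders as \<or> (\<not> exhausted as \<and> {y\<in>L 0. br y a \<in> A as 0} \<subseteq> K)"
proof -
  show K: "a \<in> K" "add_sub K" using assms by (auto simp: avoiders_def)
  obtain ds b cs where *: "a # as = ds @ b # cs" "\<not> exhausted cs" "{y\<in>L 0. br y b \<in> A cs 0} \<subseteq> K"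
    "set as \<subseteq> K"
    using assms by (auto simp: avoiders_def)
  show "K \<in> avoiders as \<or> (\<not> exhausted as \<and> {y\<in>L 0. br y a \<in> A as 0} \<subseteq> K)"
  proof (cases ds)
    case Nil
    then show ?thesis using * by simp
  next
    case (Cons d ds')
    then have "as = ds' @ b # cs" using * by simp
    then show ?thesis using * K unfolding avoiders_def by blast
  qed
qed

text \<open>The new letter \<open>a\<close> avoids the radical of \<open>C\<close> and a subgroup
  \<open>H\<close> outside which all elements are good. Where \<open>[C a, x]\<close> is nonzero, it
  is a bracket that falls into \<open>A (a # as)\<close>. Elsewhere \<open>[C e, x]\<close> takes
  over, and the goodness of the shifted element comes from the previous step.\<close>

lemma isotropic_extension:
  assumes as: "set as \<subseteq> L 0"
    and prev: "all_good as \<or> (\<exists>a0 bs C0 d0. as = a0 # bs \<and> isotropic_step a0 bs C0 d0 \<and>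
      (\<not> nonzero as C0 d0 \<or> C0 = C \<and> d0 = d))"
    and C: "lin C d" "alternating as C d" "nonzero as C d"
    and id: "\<not> exhausted as \<Longrightarrow> d = 0 \<and> C = (\<lambda>x. x)"
  shows "\<exists>a\<in>L 0. good as a \<and> isotropic_step a as C d"
proof -
  define R where "R = {x\<in>L 0. \<forall>y\<in>L 0. br (C x) y \<in> A as d}"
  have R: "add_sub R" "\<exists>x\<in>L 0. x \<notin> R"
    using radical_sub[OF C(1)] C(3) by (auto simp: R_def nonzero_def)
  \<comment> \<open>If all elements are good, any proper subgroup can serve as \<open>H\<close>, and
    the radical \<open>R\<close> is taken.\<close>
  obtain H where H: "add_sub H" "\<And>x. x \<in> L 0 \<Longrightarrow> x \<notin> H \<Longrightarrow> good as x" "\<exists>x\<in>L 0. x \<notin> H"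
    and Hprev: "all_good as \<or> (\<exists>a0 bs C0 d0. as = a0 # bs \<and> isotropic_step a0 bs C0 d0 \<and>
      (\<not> nonzero as C0 d0 \<or> C0 = C \<and> d0 = d) \<and> H = {x\<in>L 0. br (C0 a0) x \<in> A bs d0})"
  proof (cases "all_good as")
    case True
    obtain x where "x \<in> L 0" "x \<notin> R" using R(2) by blast
    then have "add_sub R" "\<And>x. x \<in> L 0 \<Longrightarrow> x \<notin> R \<Longrightarrow> good as x" "\<exists>x\<in>L 0. x \<notin> R"
      using R(1) True by (auto simp: all_good_def)
    then show ?thesis using that True by blast
  next
    case False
    then obtain a0 bs C0 d0 where p: "as = a0 # bs" "isotropic_step a0 bs C0 d0"
      "\<not> nonzero as C0 d0 \<or> C0 = C \<and> d0 = d" using prev by blast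
    let ?H = "{x\<in>L 0. br (C0 a0) x \<in> A bs d0}"
    have "\<And>x. x \<in> L 0 \<Longrightarrow> x \<notin> ?H \<Longrightarrow> good as x" "\<exists>x\<in>L 0. x \<notin> ?H"
      using p(1,2) unfolding isotropic_step_def by blast+
    then show ?thesis using that[of ?H] kernel_sub p by blast
  qed
  obtain a where a: "a \<in> L 0" "a \<notin> H" "a \<notin> R"
    using add_sub_not_Un[OF sub_L H(1) R(1) H(3) R(2)] by blast
  \<comment> \<open>Shifting \<open>x\<close> by \<open>a\<close> moves it off \<open>H\<close> if
    necessary; as the form is alternating, this does not change \<open>[C a, x]\<close> modulo
    \<open>A as\<close>.\<close>
  have good_by_form: "good (a # as) x" if x: "x \<in> L 0" "br (C a) x \<notin> A as d" for x
  proof -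
    obtain y where y: "y \<in> L 0" "y \<notin> H" "y = x \<or> y = x + a"
      using translate_out[OF sub_L H(1) a(1) x(1)] a(2) by blast
    have "br (C a) a \<in> A as d" using C(2) a(1) by (simp add: alternating_def)
    then have "br (C a) y \<notin> A as d"
      using x(2) y(3) add_sub_add_iff'[OF sub_A] by (auto simp: br_add_right)
    moreover have "C a \<in> L d" using C(1) a(1) by (simp add: lin_def)
    ultimately show ?thesis
      using good_Cons[OF as a(1) x(1) y(1) H(2)[OF y(1,2)]]
        alternating_mem_Cons[OF C(1,2) y(1) a(1)] translate_aspan[OF y(3)] by blast
  qed
  \<comment> \<open>Since \<open>e\<close> pairs nontrivially with \<open>a\<close>, a shift by
    \<open>a\<close> makes \<open>[C e, x]\<close> nonzero modulo \<open>A as\<close>. This fixes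
    the shift, so \<open>H\<close> cannot be avoided as well; the goodness of \<open>y\<close> has
    to come from the \<open>avoiders\<close> clause of the previous step, with \<open>a\<close> in
    the role of \<open>e\<close>.\<close>
  have good_by_other: "good (a # as) x"
    if K: "K \<in> avoiders (a # as)" and x: "x \<in> L 0" "x \<notin> K" and e: "e \<in> L 0"
      "br (C a) e \<notin> A as d" "br (C e) x \<in> A (a # as) d" for K x e
  proof (cases "br (C a) x \<in> A as d")
    case False
    then show ?thesis using good_by_form x by blast
  next
    case True
    have Ce: "C e \<in> L d" using C(1) e(1) by (simp add: lin_def)
    have ea: "br (C e) a \<notin> A as d" using e alternating_br_iff[OF C(1,2) e(1) a(1)] by simp
    obtain y where y: "y \<in> L 0" "br (C e) y \<notin> A as d" "y = x \<or> y = x + a"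
      using translate_out[OF sub_L kernel_sub[of "C e" as d] a(1) x(1)] ea by blast
    have ey: "br (C e) y \<in> A (a # as) d"
      using y(3) e(3) br_mem_A[of a "a # as" "C e" d] Ce add_sub_add[OF sub_A]
      by (auto simp: br_add_right)
    have yK: "y \<notin> K" using x(2) y(3) avoiders_Cons(1,2)[OF K] add_sub_add_iff' by metis
    have ay: "br (C a) y \<in> A as d"
      using True y(3) C(2) a(1) add_sub_add[OF sub_A]
      by (auto simp: br_add_right alternating_def)
    have "good as y"
    proof (rule disjE[OF Hprev])
      assume "all_good as"
      then show ?thesis using y(1) by (simp add: all_good_def)
    next
      assume "\<exists>a0 bs C0 d0. as = a0 # bs \<and> isotropic_step a0 bs C0 d0 \<and>
        (\<not> nonzero as C0 d0 \<or> C0 = C \<and> d0 = d) \<and> H = {x\<in>L 0. br (C0 a0) x \<in> A bs d0}"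
      then obtain a0 bs C0 d0 where p: "as = a0 # bs" "isotropic_step a0 bs C0 d0"
        "\<not> nonzero as C0 d0 \<or> C0 = C \<and> d0 = d" "H = {x\<in>L 0. br (C0 a0) x \<in> A bs d0}" by blast
      \<comment> \<open>If \<open>K\<close> came from the new letter \<open>a\<close>, then
        \<open>as\<close> would not be exhausted and \<open>C\<close> would be the identity, so the
        orthogonality of \<open>y\<close> to \<open>a\<close> would put \<open>y\<close> into
        \<open>K\<close>.\<close>
      have "K \<in> avoiders as"
      proof (rule ccontr)
        assume "K \<notin> avoiders as"
        then have *: "\<not> exhausted as" "{y\<in>L 0. br y a \<in> A as 0} \<subseteq> K"
          using avoiders_Cons(3)[OF K] by auto
        then have "d = 0" "C = (\<lambda>x. x)" using id by auto
        then have "br y a \<in> A as 0" using ay alternating_br_iff[OF C(1,2) a(1) y(1)] by simp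
        then show False using * y(1) yK by blast
      qed
      moreover have "br (C0 a0) a \<notin> A bs d0" using a p(4) by blast
      \<comment> \<open>Either the previous form has become zero modulo \<open>A as\<close>, or it
        is the form \<open>C\<close>, for which \<open>y\<close> is orthogonal to
        \<open>a\<close>.\<close>
      moreover have "br (C0 a) y \<in> A as d0"
        using p(3) ay a(1) y(1) unfolding nonzero_def by blast
      ultimately show ?thesis
        using p(1,2) y(1) yK a(1) unfolding isotropic_step_def by blast
    qed
    then show ?thesis
      using good_Cons[OF as a(1) x(1) y(1) _ Ce ey y(2) translate_aspan[OF y(3)]] by blast
  qed
  have "isotropic_step a as C d"
    unfolding isotropic_step_def
    using C a(1,3) good_by_form good_by_other id exhausted_mono unfolding R_def by blast
  then show ?thesis using a H(2) by blast
qed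

text \<open>As \<open>[C a, a]\<close> is nonzero, every \<open>x\<close> can be shifted by
  \<open>a\<close> out of the kernel of \<open>[C a, _]\<close>. This kernel is an avoider, so the
  shifted element is good, and by symmetry its bracket with \<open>C a\<close> falls into
  \<open>A (a # as)\<close>. No exceptional elements remain.\<close>

lemma anisotropic_extension:
  assumes as: "set as \<subseteq> L 0"
    and prev: "all_good as \<or> (\<exists>a0 bs C0 d0. as = a0 # bs \<and> isotropic_step a0 bs C0 d0 \<and>
      \<not> nonzero as C0 d0 \<and> br (C0 a0) a \<notin> A bs d0)"
    and exh: "exhausted as"
    and C: "lin C d" "symmetric as C d" "\<forall>z\<in>L 0. {x\<in>L 0. br (C z) x \<in> A as d} \<in> avoiders as"
    and a: "a \<in> L 0" "br (C a) a \<notin> A as d"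
  shows "all_good (a # as)"
proof -
  have Ca: "C a \<in> L d" using C(1) a(1) by (simp add: lin_def)
  have form_good: "good as y" if y: "y \<in> L 0" "br (C a) y \<notin> A as d" for y
  proof (rule disjE[OF prev])
    assume "all_good as"
    then show ?thesis using y(1) by (simp add: all_good_def)
  next
    assume "\<exists>a0 bs C0 d0. as = a0 # bs \<and> isotropic_step a0 bs C0 d0 \<and>
      \<not> nonzero as C0 d0 \<and> br (C0 a0) a \<notin> A bs d0"
    then obtain a0 bs C0 d0 where p: "as = a0 # bs" "isotropic_step a0 bs C0 d0"
      "\<not> nonzero as C0 d0" "br (C0 a0) a \<notin> A bs d0" by blast
    \<comment> \<open>The previous form is zero modulo \<open>A as\<close>, so the
      \<open>avoiders\<close> clause of the previous step applies with \<open>a\<close> in the role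
      of \<open>e\<close>.\<close>
    have "br (C0 a) y \<in> A as d0" using p(3) a(1) y(1) unfolding nonzero_def by blast
    moreover have "{x\<in>L 0. br (C a) x \<in> A as d} \<in> avoiders as" using C(3) a(1) by blast
    moreover have "y \<notin> {x\<in>L 0. br (C a) x \<in> A as d}" using y by blast
    moreover have "good as y" if "K \<in> avoiders as" "y \<notin> K" "br (C0 a) y \<in> A as d0" for K
      using p(2,4) that y(1) a(1) unfolding isotropic_step_def p(1) by blast
    ultimately show ?thesis by blast
  qed
  have "good (a # as) x" if x: "x \<in> L 0" for x
  proof -
    obtain y where y: "y \<in> L 0" "br (C a) y \<notin> A as d" "y = x \<or> y = x + a"
      using translate_out[OF sub_L kernel_sub[of "C a" as d] a(1) x] a(2) by blast
    have "br (C a) y - br (C y) a \<in> A (a # as) d"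
      using C(2) a(1) y(1) A_mono unfolding symmetric_def by blast
    moreover have "br (C y) a \<in> A (a # as) d"
      using C(1) y(1) by (intro br_mem_A) (auto simp: lin_def)
    ultimately have "br (C a) y \<in> A (a # as) d" using add_sub_diff_iff[OF sub_A] by blast
    then show ?thesis
      using good_Cons[OF as a(1) x y(1) form_good[OF y(1,2)] Ca _ y(2) translate_aspan[OF y(3)]]
      by blast
  qed
  then show ?thesis using exh exhausted_mono by (simp add: all_good_def)
qed

text \<open>If \<open>C\<close> is not alternating, then \<open>2C\<close> is, by polarization.\<close>

lemma symmetric_isotropic_off:
  assumes C: "lin C d" "symmetric as C d" "nonzero as C d"
    and H: "add_sub H" "\<exists>x\<in>L 0. x \<notin> H"
    and iso: "\<And>x. x \<in> L 0 \<Longrightarrow> x \<notin> H \<Longrightarrow> br (C x) x \<in> A as d"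
  shows "\<exists>D. lin D d \<and> alternating as D d \<and> nonzero as D d"
proof (cases "alternating as C d")
  case True
  then show ?thesis using C by blast
next
  case False
  then obtain h where h: "h \<in> L 0" "br (C h) h \<notin> A as d" by (auto simp: alternating_def)
  obtain a where a: "a \<in> L 0" "a \<notin> H" using H by blast
  let ?D = "\<lambda>x. C x + C x"
  \<comment> \<open>Both \<open>a + x\<close> and \<open>a - x\<close> lie outside \<open>H\<close>,
    hence are isotropic. Adding the two relations puts \<open>2 [C x, x]\<close> into
    \<open>A as d\<close>.\<close>
  have polar: "br (C x) x + (br (C a) x + br (C x) a) \<in> A as d"
    "br (C x) x - (br (C a) x + br (C x) a) \<in> A as d" if x: "x \<in> L 0" "x \<in> H" for x
  proof -
    have *: "a + x \<in> L 0" "a - x \<in> L 0" "a + x \<notin> H" "a - x \<notin> H"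
      using a x add_sub_add[OF sub_L] add_sub_diff[OF sub_L] add_sub_add_iff'[OF H(1)]
      by (auto, metis add_sub_add_iff'[OF H(1)] diff_add_cancel)
    have "br (C (a + x)) (a + x) - br (C a) a \<in> A as d" "br (C (a - x)) (a - x) - br (C a) a \<in> A as d"
      using iso * a add_sub_diff[OF sub_A] by auto
    moreover have "C (a + x) = C a + C x" "C (a - x) = C a - C x"
      using C(1) lin_diff by (auto simp: lin_def)
    ultimately show "br (C x) x + (br (C a) x + br (C x) a) \<in> A as d"
      "br (C x) x - (br (C a) x + br (C x) a) \<in> A as d"
      by (auto simp: br_add_left br_add_right br_diff_left br_diff_right algebra_simps)
  qed
  have "br (C x) x + br (C x) x \<in> A as d" if "x \<in> L 0" for x
  proof (cases "x \<in> H")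
    case True
    from add_sub_add[OF sub_A polar[OF that True]] show ?thesis by simp
  next
    case False
    then show ?thesis using iso that add_sub_add[OF sub_A] by blast
  qed
  then have "alternating as ?D d" by (simp add: alternating_def br_add_left)
  moreover have "lin ?D d"
    using C(1) add_sub_add[OF sub_L] by (auto simp: lin_def algebra_simps)
  \<comment> \<open>By symmetry \<open>[?D a, h]\<close> is congruent to
    \<open>[C a, h] + [C h, a]\<close>, so if it vanished, polarization would make \<open>h\<close>
    isotropic.\<close>
  moreover have "br (?D a) h \<notin> A as d"
  proof
    assume D: "br (?D a) h \<in> A as d"
    have "br (C a) h - br (C h) a \<in> A as d" using C(2) a h by (simp add: symmetric_def)
    from add_sub_diff[OF sub_A D this] have "br (C a) h + br (C h) a \<in> A as d"
      by (simp add: br_add_left)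
    moreover have "h \<in> H" using h iso by blast
    ultimately have "br (C h) h \<in> A as d" using polar(1) h(1) add_sub_add_iff'[OF sub_A] by blast
    then show False using h by blast
  qed
  then have "nonzero as ?D d" using a h by (auto simp: nonzero_def)
  ultimately show ?thesis by blast
qed

text \<open>A form stays in use as long as it is nonzero modulo \<open>A as\<close>. Once it
  vanishes, degree two is exhausted and \<open>exists_form\<close> supplies another one. A nonzero
  alternating form is preferred; only if there is none, an anisotropic element of a symmetric form
  is chosen, which makes all elements good.\<close>

lemma extendible_extension:
  assumes ext: "extendible as" and nf: "\<exists>d. A as d \<noteq> L (Suc d)"
  shows "\<exists>a\<in>L 0. good as a \<and> extendible (a # as) \<and> (\<exists>d. \<exists>l\<in>L d. br l a \<notin> A as d)"
proof -
  have as: "set as \<subseteq> L 0" using ext by (simp add: extendible_def)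
  have iso_done: ?thesis if a: "a \<in> L 0" "good as a" "isotropic_step a as C d" for a C d
  proof -
    from a(3) obtain e where e: "e \<in> L 0" "br (C a) e \<notin> A as d"
      and C: "lin C d" "alternating as C d" by (auto simp: isotropic_step_def)
    then have "br (C e) a \<notin> A as d" "C e \<in> L d"
      using alternating_br_iff[OF C a(1) e(1)] by (auto simp: lin_def)
    then show ?thesis using a as unfolding extendible_def by fastforce
  qed
  show ?thesis
  proof (cases "\<exists>a0 bs C0 d0. as = a0 # bs \<and> isotropic_step a0 bs C0 d0 \<and> nonzero as C0 d0")
    case True
    then obtain a0 bs C0 d0 where p: "as = a0 # bs" "isotropic_step a0 bs C0 d0" "nonzero as C0 d0"
      by blast
    then have "lin C0 d0" "alternating as C0 d0" "\<not> exhausted as \<Longrightarrow> d0 = 0 \<and> C0 = (\<lambda>x. x)"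
      using alternating_mono by (auto simp: isotropic_step_def)
    then show ?thesis using isotropic_extension[OF as, of C0 d0] p iso_done by blast
  next
    case False
    then have prev: "all_good as \<or> (\<exists>a0 bs C0 d0. as = a0 # bs \<and> isotropic_step a0 bs C0 d0 \<and>
      \<not> nonzero as C0 d0)" using ext by (auto simp: extendible_def)
    \<comment> \<open>Before degree two is exhausted, the form is the bracket itself, and this is
      then nonzero.\<close>
    have exh: "exhausted as"
    proof (rule disjE[OF prev])
      assume "\<exists>a0 bs C0 d0. as = a0 # bs \<and> isotropic_step a0 bs C0 d0 \<and> \<not> nonzero as C0 d0"
      then obtain a0 bs C0 d0 where p: "as = a0 # bs" "isotropic_step a0 bs C0 d0"
        "\<not> nonzero as C0 d0" by blast
      show ?thesis
      proof (rule ccontr)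
        assume n: "\<not> exhausted as"
        then have "d0 = 0" "C0 = (\<lambda>x. x)" using p(1,2) unfolding isotropic_step_def by blast+
        then show False using p(3) n unfolding nonzero_def exhausted_def by blast
      qed
    qed (simp add: all_good_def)
    have iso: ?thesis if "lin C d" "alternating as C d" "nonzero as C d" for C d
      using isotropic_extension[OF as _ that] prev exh iso_done by blast
    obtain C d where C: "lin C d" "nonzero as C d"
      "alternating as C d \<or>
       symmetric as C d \<and> (\<forall>z\<in>L 0. {x\<in>L 0. br (C z) x \<in> A as d} \<in> avoiders as)"
      using exists_form[OF as exh nf] by blast
    show ?thesis
    proof (cases "\<exists>D d. lin D d \<and> alternating as D d \<and> nonzero as D d")
      case True
      then show ?thesis using iso by blast
    next
      case noalt: False
      then have sym: "symmetric as C d"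
        "\<forall>z\<in>L 0. {x\<in>L 0. br (C z) x \<in> A as d} \<in> avoiders as" using C by auto
      \<comment> \<open>The letter must be anisotropic and also lie outside the kernel
        \<open>?H\<close> left by the previous step. If this were impossible,
        \<open>symmetric_isotropic_off\<close> would give an alternating form, contrary to
        \<open>noalt\<close>.\<close>
      have "\<exists>a\<in>L 0. br (C a) a \<notin> A as d \<and> good as a \<and> (all_good as \<or>
        (\<exists>a0 bs C0 d0. as = a0 # bs \<and> isotropic_step a0 bs C0 d0 \<and>
          \<not> nonzero as C0 d0 \<and> br (C0 a0) a \<notin> A bs d0))"
      proof (rule disjE[OF prev])
        assume g: "all_good as"
        obtain a where "a \<in> L 0" "br (C a) a \<notin> A as d"
          using noalt C(1,2) unfolding alternating_def by blast
        then show ?thesis using g by (auto simp: all_good_def)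
      next
        assume "\<exists>a0 bs C0 d0. as = a0 # bs \<and> isotropic_step a0 bs C0 d0 \<and> \<not> nonzero as C0 d0"
        then obtain a0 bs C0 d0 where p: "as = a0 # bs" "isotropic_step a0 bs C0 d0"
          "\<not> nonzero as C0 d0" by blast
        let ?H = "{x\<in>L 0. br (C0 a0) x \<in> A bs d0}"
        have "\<exists>x\<in>L 0. x \<notin> ?H" using p(2) by (auto simp: isotropic_step_def)
        then obtain a where a: "a \<in> L 0" "a \<notin> ?H" "br (C a) a \<notin> A as d"
          using symmetric_isotropic_off[OF C(1) sym(1) C(2) kernel_sub] noalt by blast
        moreover have "good as a" using a p(1,2) by (auto simp: isotropic_step_def)
        ultimately show ?thesis using p by blast
      qed
      then obtain a where a: "a \<in> L 0" "br (C a) a \<notin> A as d" "good as a"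
        "all_good as \<or> (\<exists>a0 bs C0 d0. as = a0 # bs \<and> isotropic_step a0 bs C0 d0 \<and>
          \<not> nonzero as C0 d0 \<and> br (C0 a0) a \<notin> A bs d0)" by blast
      have "all_good (a # as)"
        using anisotropic_extension[OF as a(4) exh C(1) sym a(1,2)] .
      moreover have "C a \<in> L d" using C(1) a(1) by (simp add: lin_def)
      ultimately show ?thesis using a as unfolding extendible_def by fastforce
    qed
  qed
qed

text \<open>The first letter is taken from \<open>U\<close>, whose elements are good at the outset,
  and the form is the plain bracket, alternating by \<open>alt\<close>. An avoider of
  \<open>[a]\<close> contains the kernel of bracketing with \<open>a\<close>, so the
  \<open>avoiders\<close> clause reduces to the case of nonzero \<open>[a, x]\<close>.\<close>

lemma extendible_singleton:
  assumes "\<not> exhausted []"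
  shows "\<exists>a\<in>L 0. good [] a \<and> extendible [a] \<and> (\<exists>d. \<exists>l\<in>L d. br l a \<notin> A [] d)"
proof -
  let ?K = "{x\<in>L 0. \<forall>y\<in>L 0. br x y \<in> A [] 0}"
  let ?I = "\<lambda>x. x"
  have lin: "lin ?I 0" by (simp add: lin_def)
  have alt0: "alternating [] ?I 0" using alt by (simp add: alternating_def)
  have "N 0 \<subseteq> ?K" using N_le_L br_N_left[of _ 0 _ 0] by auto
  then obtain a where a: "a \<in> U" "a \<notin> ?K"
    using U_not_le[OF radical_sub[OF lin, of "[]"]] assms unfolding exhausted_def by blast
  then have aL: "a \<in> L 0" using U_le_L by auto
  then obtain e where e: "e \<in> L 0" "br a e \<notin> A [] 0" using a by auto
  have aa: "br a z \<in> A [] 0" if "z \<in> aspan {a}" for z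
    using aspan_least[of "{z. br a z \<in> A [] 0}" "{a}"] that alt[OF aL] sub_A[of "[]" 0]
    by (auto simp: add_sub_def br_diff_right)
  have g: "good [a] x" if x: "x \<in> L 0" "br a x \<notin> A [] 0" for x
  proof -
    obtain y where y: "y \<in> U" "x - y \<in> aspan {a}" using U_translate[OF a(1) x(1)] by blast
    then have yL: "y \<in> L 0" using U_le_L by auto
    have "br a y \<notin> A [] 0"
      using aa[OF y(2)] x(2) add_sub_diff_iff[OF sub_A] by (simp only: br_diff_right) blast
    then show ?thesis
      using good_Cons[OF _ aL x(1) yL good_Nil[OF y(1)] aL _ _ y(2)]
        alternating_mem_Cons[OF lin alt0 yL aL] by simp
  qed
  have other: "good [a] x" if "K \<in> avoiders [a]" "x \<in> L 0" "x \<notin> K" for K x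
  proof -
    have "{y\<in>L 0. br y a \<in> A [] 0} \<subseteq> K"
      using that(1) by (auto simp: avoiders_def Cons_eq_append_conv)
    then have "br a x \<notin> A [] 0"
      using that(2,3) alternating_br_iff[OF lin alt0 aL that(2)] by blast
    then show ?thesis using g that by blast
  qed
  have "isotropic_step a [] ?I 0"
    unfolding isotropic_step_def using lin alt0 e g other by blast
  moreover have "br e a \<notin> A [] 0" using e alternating_br_iff[OF lin alt0 aL e(1)] by blast
  ultimately show ?thesis using aL good_Nil[OF a(1)] e(1) unfolding extendible_def by fastforce
qed

end

section \<open>The lower central series\<close>

definition com :: "('a, 'b) monoid_scheme \<Rightarrow> 'a \<Rightarrow> 'a \<Rightarrow> 'a" where
  "com G x y = x \<otimes>\<^bsub>G\<^esub> y \<otimes>\<^bsub>G\<^esub> inv\<^bsub>G\<^esub> x \<otimes>\<^bsub>G\<^esub> inv\<^bsub>G\<^esub> y"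

text \<open>\<open>lcs G d\<close> is the term usually denoted by \<open>\<gamma>\<^bsub>d+1\<^esub>(G)\<close>.\<close>

primrec lcs :: "('a, 'b) monoid_scheme \<Rightarrow> nat \<Rightarrow> 'a set" where
  "lcs G 0 = carrier G"
| "lcs G (Suc d) = generate G {com G g x |g x. g \<in> lcs G d \<and> x \<in> carrier G}"

declare lcs.simps(2) [simp del]

lemma derived_eq_lcs: "derived G (carrier G) = lcs G 1"
  unfolding derived_def One_nat_def lcs.simps com_def by (rule arg_cong[of _ _ "generate G"]) auto

context group
begin

section \<open>Commutator identities\<close>

lemma cancel_left1: "x \<in> carrier G \<Longrightarrow> y \<in> carrier G \<Longrightarrow> x \<otimes> (inv x \<otimes> y) = y"
  by (simp add: m_assoc[symmetric])

lemma cancel_left2: "x \<in> carrier G \<Longrightarrow> y \<in> carrier G \<Longrightarrow> inv x \<otimes> (x \<otimes> y) = y"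
  by (simp add: m_assoc[symmetric])

text \<open>These rules bring group words into right-associated, freely reduced form, which proves
  the identities valid in all groups.\<close>

lemmas word_simps = m_assoc inv_mult_group cancel_left1 cancel_left2

lemma com_closed [simp]: "x \<in> carrier G \<Longrightarrow> y \<in> carrier G \<Longrightarrow> com G x y \<in> carrier G"
  by (simp add: com_def)

lemma inv_com: "x \<in> carrier G \<Longrightarrow> y \<in> carrier G \<Longrightarrow> inv (com G x y) = com G y x"
  by (simp add: com_def word_simps)

lemma com_self: "x \<in> carrier G \<Longrightarrow> com G x x = \<one>"
  by (simp add: com_def word_simps)

lemma com_eq_one_iff:
  "x \<in> carrier G \<Longrightarrow> y \<in> carrier G \<Longrightarrow> com G x y = \<one> \<longleftrightarrow> x \<otimes> y = y \<otimes> x"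
proof -
  assume xy: "x \<in> carrier G" "y \<in> carrier G"
  have "com G x y \<otimes> (y \<otimes> x) = x \<otimes> y" using xy by (simp add: com_def word_simps)
  then show ?thesis using xy
    by (metis com_closed l_one m_closed r_cancel one_closed)
qed

lemma com_mult_left: "\<lbrakk>x \<in> carrier G; y \<in> carrier G; z \<in> carrier G\<rbrakk> \<Longrightarrow>
  com G (x \<otimes> y) z = com G x (com G y z) \<otimes> com G y z \<otimes> com G x z"
  by (simp add: com_def word_simps)

lemma com_mult_right: "\<lbrakk>x \<in> carrier G; y \<in> carrier G; z \<in> carrier G\<rbrakk> \<Longrightarrow>
  com G x (y \<otimes> z) = com G x y \<otimes> (y \<otimes> com G x z \<otimes> inv y)"
  by (simp add: com_def word_simps)

lemma com_inv_right: "\<lbrakk>x \<in> carrier G; y \<in> carrier G\<rbrakk> \<Longrightarrow>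
  com G x (inv y) = inv y \<otimes> inv (com G x y) \<otimes> y"
  by (simp add: com_def word_simps)

text \<open>Both sides are obtained from \<open>[gh, k]\<close>, writing \<open>gh\<close> as \<open>[g, h] hg\<close> for the right-hand one.\<close>

lemma com_com_identity:
  assumes "g \<in> carrier G" "h \<in> carrier G" "k \<in> carrier G"
  shows "com G g (com G h k) \<otimes> (com G h k \<otimes> com G g k) =
    com G (com G g h) (com G (h \<otimes> g) k) \<otimes> (com G h (com G g k) \<otimes> (com G g k \<otimes> com G h k)) \<otimes>
    com G (com G g h) k"
  using assms by (simp add: com_def word_simps)

text \<open>In \<open>com_com_identity\<close> the first factor on the right is trivial by 1, the
  two orders of \<open>[g, k]\<close> and \<open>[h, k]\<close> agree by 2, and
  \<open>[[g, h], k]\<close> is central by 3, so the common factor cancels.\<close>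

lemma jacobi_exact:
  assumes g: "g \<in> carrier G" "h \<in> carrier G" "k \<in> carrier G"
    and 1: "com G (com G g h) (com G (h \<otimes> g) k) = \<one>"
    and 2: "com G (com G g k) (com G h k) = \<one>"
    and 3: "\<And>x. x \<in> carrier G \<Longrightarrow> com G (com G (com G g h) k) x = \<one>"
  shows "com G g (com G h k) = com G h (com G g k) \<otimes> com G (com G g h) k"
proof -
  let ?u = "com G h k \<otimes> com G g k"
  have comm: "com G g k \<otimes> com G h k = ?u" using 2 g by (simp add: com_eq_one_iff)
  have "?u \<otimes> com G (com G g h) k = com G (com G g h) k \<otimes> ?u"
    using 3[of ?u] g by (simp add: com_eq_one_iff)
  then have "com G g (com G h k) \<otimes> ?u = com G h (com G g k) \<otimes> com G (com G g h) k \<otimes> ?u"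
    using com_com_identity[OF g] g comm 1 by (simp add: m_assoc)
  then show ?thesis using g by (simp add: r_cancel)
qed

end

section \<open>Commutators modulo a normal subgroup\<close>

lemma (in normal) coset_mult_FactGroup:
  "x \<in> carrier G \<Longrightarrow> y \<in> carrier G \<Longrightarrow> (H #> x) \<otimes>\<^bsub>G Mod H\<^esub> (H #> y) = H #> (x \<otimes> y)"
  by (simp add: rcos_sum)

lemma (in normal) com_FactGroup:
  assumes "x \<in> carrier G" "y \<in> carrier G"
  shows "com (G Mod H) (H #> x) (H #> y) = H #> com G x y"
proof -
  have inv: "inv\<^bsub>G Mod H\<^esub> (H #> z) = H #> inv z" if "z \<in> carrier G" for z
    using that by (simp add: inv_FactGroup rcos_inv carrier_FactGroup)
  show ?thesis using assms by (simp add: com_def inv rcos_sum)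
qed

lemma (in normal) coset_eq_one_iff: "x \<in> carrier G \<Longrightarrow> H #> x = \<one>\<^bsub>G Mod H\<^esub> \<longleftrightarrow> x \<in> H"
  using coset_join1[OF _ _ subgroup_axioms] coset_join2[OF _ subgroup_axioms] by auto

lemma (in normal) coset_eq_iff:
  assumes "x \<in> carrier G" "y \<in> carrier G"
  shows "H #> x = H #> y \<longleftrightarrow> x \<otimes> inv y \<in> H"
proof -
  have "H #> x = H #> y \<longleftrightarrow> H #> (x \<otimes> inv y) = H"
    using assms coset_mult_inv1[of H x y] coset_mult_inv2[of H x y] subset by auto
  then show ?thesis using coset_eq_one_iff assms by simp
qed

text \<open>This is \<open>jacobi_exact\<close> in \<open>G Mod H\<close>. It serves twice: for the
  filtration property \<open>com_lcs\<close> and, one term further down, for the Jacobi identity of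
  the Lie ring.\<close>

lemma (in normal) jacobi_mod:
  assumes G: "g \<in> carrier G" "h \<in> carrier G" "k \<in> carrier G"
    and 1: "com G (com G g h) (com G (h \<otimes> g) k) \<in> H"
    and 2: "com G (com G g k) (com G h k) \<in> H"
    and 3: "\<And>x. x \<in> carrier G \<Longrightarrow> com G (com G (com G g h) k) x \<in> H"
  shows "com G g (com G h k) \<otimes> inv (com G h (com G g k) \<otimes> com G (com G g h) k) \<in> H"
proof -
  interpret Q: group "G Mod H" by (rule factorgroup_is_group)
  let ?q = "\<lambda>x. H #> x"
  have q: "?q x \<in> carrier (G Mod H)" if "x \<in> carrier G" for x
    using that by (auto simp: carrier_FactGroup)
  have one: "?q x = \<one>\<^bsub>G Mod H\<^esub>" if "x \<in> H" for x
    using that coset_eq_one_iff subset by blast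
  have "com (G Mod H) (?q g) (com (G Mod H) (?q h) (?q k)) =
    com (G Mod H) (?q h) (com (G Mod H) (?q g) (?q k)) \<otimes>\<^bsub>G Mod H\<^esub>
    com (G Mod H) (com (G Mod H) (?q g) (?q h)) (?q k)"
  proof (rule Q.jacobi_exact)
    fix x assume "x \<in> carrier (G Mod H)"
    then obtain y where y: "y \<in> carrier G" "x = ?q y" by (auto simp: carrier_FactGroup)
    then show "com (G Mod H) (com (G Mod H) (com (G Mod H) (?q g) (?q h)) (?q k)) x = \<one>\<^bsub>G Mod H\<^esub>"
      using G by (simp only: com_FactGroup com_closed one[OF 3[OF y(1)]])
  qed (use G q in \<open>simp_all only: com_FactGroup coset_mult_FactGroup com_closed m_closed
      one[OF 1] one[OF 2]\<close>)
  then have "?q (com G g (com G h k)) = ?q (com G h (com G g k) \<otimes> com G (com G g h) k)"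
    using G by (simp only: com_FactGroup coset_mult_FactGroup com_closed)
  then show ?thesis using coset_eq_iff G by simp
qed

context group
begin

section \<open>The lower central series as a filtration\<close>

lemma com_conj: "\<lbrakk>x \<in> carrier G; y \<in> carrier G; g \<in> carrier G\<rbrakk> \<Longrightarrow>
  g \<otimes> com G x y \<otimes> inv g = com G (g \<otimes> x \<otimes> inv g) (g \<otimes> y \<otimes> inv g)"
  by (simp add: com_def word_simps)

lemma lcs_normal: "lcs G d \<lhd> G"
proof (induction d)
  case 0
  then show ?case using normal_self by simp
next
  case (Suc d)
  interpret D: normal "lcs G d" G by (rule Suc)
  show ?case unfolding lcs.simps
  proof (rule normal_generateI)
    show "{com G g x |g x. g \<in> lcs G d \<and> x \<in> carrier G} \<subseteq> carrier G" using D.subset by auto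
    fix h y assume "h \<in> {com G g x |g x. g \<in> lcs G d \<and> x \<in> carrier G}" and y: "y \<in> carrier G"
    then obtain g x where h: "h = com G g x" "g \<in> lcs G d" "x \<in> carrier G" by auto
    then have "y \<otimes> h \<otimes> inv y = com G (y \<otimes> g \<otimes> inv y) (y \<otimes> x \<otimes> inv y)"
      using com_conj y D.subset by auto
    then show "y \<otimes> h \<otimes> inv y \<in> {com G g x |g x. g \<in> lcs G d \<and> x \<in> carrier G}"
      using D.inv_op_closed2[OF y h(2)] h(3) y by auto
  qed
qed

lemma lcs_subgroup: "subgroup (lcs G d) G"
  using lcs_normal normal_imp_subgroup by blast

lemma lcs_le_carrier: "lcs G d \<subseteq> carrier G"
  using lcs_subgroup subgroup.subset by blast

lemma com_normal_left:
  assumes "K \<lhd> G" "k \<in> K" "x \<in> carrier G"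
  shows "com G k x \<in> K"
proof -
  interpret K: normal K G by fact
  have "x \<otimes> inv k \<otimes> inv x \<in> K" using K.inv_op_closed2[OF assms(3) K.m_inv_closed[OF assms(2)]] .
  moreover have "com G k x = k \<otimes> (x \<otimes> inv k \<otimes> inv x)"
    using assms K.subset by (auto simp: com_def word_simps)
  ultimately show ?thesis using assms(2) by simp
qed

lemma com_swap_mem:
  assumes "subgroup K G" "x \<in> carrier G" "y \<in> carrier G" "com G x y \<in> K"
  shows "com G y x \<in> K"
  using assms by (metis inv_com subgroup.m_inv_closed)

lemma com_mem_lcs_Suc: "g \<in> lcs G d \<Longrightarrow> x \<in> carrier G \<Longrightarrow> com G g x \<in> lcs G (Suc d)"
  unfolding lcs.simps by (rule generate.incl) blast

lemma lcs_Suc_le: "lcs G (Suc d) \<subseteq> lcs G d"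
  unfolding lcs.simps(2)
  by (rule generate_subgroup_incl[OF _ lcs_subgroup]) (use com_normal_left[OF lcs_normal] in auto)

lemma lcs_antimono: "i \<le> j \<Longrightarrow> lcs G j \<subseteq> lcs G i"
  by (induction rule: dec_induct) (use lcs_Suc_le in blast)+

lemma subgroup_com_left:
  assumes K: "K \<lhd> G" and S: "S \<subseteq> carrier G"
  shows "subgroup {y \<in> carrier G. \<forall>x\<in>S. com G x y \<in> K} G"
proof -
  interpret K: normal K G by fact
  show ?thesis
  proof (rule subgroup.intro)
    show "\<one> \<in> {y \<in> carrier G. \<forall>x\<in>S. com G x y \<in> K}"
      using S K.one_closed by (auto simp: com_def)
  next
    fix y z assume "y \<in> {y \<in> carrier G. \<forall>x\<in>S. com G x y \<in> K}"
      "z \<in> {y \<in> carrier G. \<forall>x\<in>S. com G x y \<in> K}"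
    then show "y \<otimes> z \<in> {y \<in> carrier G. \<forall>x\<in>S. com G x y \<in> K}"
      using S K.inv_op_closed2 K.m_closed by (auto simp: com_mult_right subset_iff)
  next
    fix y assume "y \<in> {y \<in> carrier G. \<forall>x\<in>S. com G x y \<in> K}"
    then show "inv y \<in> {y \<in> carrier G. \<forall>x\<in>S. com G x y \<in> K}"
      using S K.inv_op_closed1 K.m_inv_closed by (auto simp: com_inv_right subset_iff)
  qed auto
qed

text \<open>A three subgroups argument by induction on \<open>j\<close>: \<open>jacobi_mod\<close>
  expresses \<open>[g', [h, k']]\<close> by \<open>[h, [g', k']]\<close> and
  \<open>[[g', h], k']\<close>, to which the induction hypothesis applies.\<close>

lemma com_lcs: "g \<in> lcs G i \<Longrightarrow> k \<in> lcs G j \<Longrightarrow> com G g k \<in> lcs G (Suc (i + j))"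
proof (induction j arbitrary: g k i)
  case 0
  then show ?case using com_mem_lcs_Suc by simp
next
  case (Suc j)
  let ?T = "lcs G (Suc (i + Suc j))"
  interpret T: normal ?T G by (rule lcs_normal)
  have inj: "x \<in> carrier G" if "x \<in> lcs G e" for x e using that lcs_le_carrier by blast
  have key: "com G g' (com G h k') \<in> ?T" if g': "g' \<in> lcs G i" and k': "k' \<in> lcs G j" and h: "h \<in> carrier G"
    for g' h k'
  proof -
    note G = inj[OF g'] h inj[OF k']
    have c: "com G g' h \<in> lcs G (Suc i)" using com_mem_lcs_Suc[OF g' h] .
    have gk: "com G g' k' \<in> lcs G (Suc (i + j))" using Suc.IH[OF g' k'] .
    \<comment> \<open>Normality only places this commutator in \<open>lcs G j\<close>; that
      suffices, since \<open>[g', h]\<close> already lies one step deeper.\<close>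
    have u: "com G (h \<otimes> g') k' \<in> lcs G j"
      by (rule com_swap_mem[OF lcs_subgroup G(3) _ com_normal_left[OF lcs_normal k']])
        (rule m_closed[OF h G(1)])+
    have 1: "com G (com G g' h) (com G (h \<otimes> g') k') \<in> ?T" using Suc.IH[OF c u] by simp
    have 2: "com G (com G g' k') (com G h k') \<in> ?T" using com_mem_lcs_Suc[OF gk] G by simp
    have 3: "com G (com G g' h) k' \<in> ?T" using Suc.IH[OF c k'] by simp
    have 4: "com G h (com G g' k') \<in> ?T"
      using com_swap_mem[OF lcs_subgroup com_closed[OF G(1,3)] h com_mem_lcs_Suc[OF gk h]] by simp
    have *: "com G g' (com G h k') \<otimes> inv (com G h (com G g' k') \<otimes> com G (com G g' h) k') \<in> ?T"
      by (rule T.jacobi_mod[OF G 1 2 com_normal_left[OF lcs_normal 3]])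
    have "com G h (com G g' k') \<otimes> com G (com G g' h) k' \<in> ?T" using T.m_closed[OF 4 3] .
    from T.m_closed[OF * this] show ?thesis
      using G by (simp add: word_simps)
  qed
  have "lcs G (Suc j) \<subseteq> {y \<in> carrier G. \<forall>x\<in>lcs G i. com G x y \<in> ?T}"
    unfolding lcs.simps(2)[of G j]
  proof (rule generate_subgroup_incl[OF _ subgroup_com_left[OF lcs_normal lcs_le_carrier]], safe)
    fix k' h assume k': "k' \<in> lcs G j" and h: "h \<in> carrier G"
    note kc = inj[OF k']
    show "com G k' h \<in> carrier G" using kc h by simp
    fix x assume x: "x \<in> lcs G i"
    have "com G x (inv (com G h k')) = inv (com G h k') \<otimes> inv (com G x (com G h k')) \<otimes> com G h k'"
      using inj[OF x] kc h by (simp add: com_inv_right)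
    then have "com G x (inv (com G h k')) \<in> ?T"
      using T.inv_op_closed1 T.m_inv_closed[OF key[OF x k' h]] kc h by simp
    then show "com G x (com G k' h) \<in> ?T" using inv_com[OF h kc] by simp
  qed
  then show ?case using Suc.prems by blast
qed

text \<open>The three double commutators lie in \<open>lcs G (i + j + 2)\<close>, and the error lies
  in the next term: this is the source of the Jacobi identity of the Lie ring.\<close>

lemma com_com_lcs_identity:
  assumes g: "g \<in> lcs G i" and h: "h \<in> carrier G" and k: "k \<in> lcs G j"
  shows "com G g (com G h k) \<otimes> inv (com G h (com G g k) \<otimes> com G (com G g h) k)
    \<in> lcs G (Suc (Suc (Suc (i + j))))"
proof -
  let ?T = "lcs G (Suc (Suc (Suc (i + j))))"
  interpret T: normal ?T G by (rule lcs_normal)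
  have inj: "x \<in> carrier G" if "x \<in> lcs G e" for x e using that lcs_le_carrier by blast
  note G = inj[OF g] h inj[OF k]
  have c: "com G g h \<in> lcs G (Suc i)" using com_mem_lcs_Suc[OF g h] .
  have gk: "com G g k \<in> lcs G (Suc (i + j))" using com_lcs[OF g k] .
  have u: "com G x k \<in> lcs G (Suc j)" if "x \<in> carrier G" for x
    by (rule com_swap_mem[OF lcs_subgroup G(3) that com_mem_lcs_Suc[OF k that]])
  have 1: "com G (com G g h) (com G (h \<otimes> g) k) \<in> ?T"
    using com_lcs[OF c u[of "h \<otimes> g"]] G by simp
  have 2: "com G (com G g k) (com G h k) \<in> ?T"
    using com_lcs[OF gk u[OF h]] lcs_antimono[of "Suc (Suc (Suc (i + j)))" "Suc (Suc (i + j) + Suc j)"]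
    by auto
  have 3: "com G (com G (com G g h) k) x \<in> ?T" if "x \<in> carrier G" for x
    using com_mem_lcs_Suc[OF com_lcs[OF c k] that] by simp
  show ?thesis by (rule T.jacobi_mod[OF G 1 2 3])
qed

end

section \<open>Finite p-groups\<close>

locale finite_p_group = group G for G (structure) +
  fixes p :: nat
  assumes finite_carrier: "finite (carrier G)"
    and prime: "Factorial_Ring.prime p"
    and order_power: "\<exists>k. order G = p ^ k"
begin

lemma p_gt_1: "1 < p"
  using prime by (rule prime_gt_1_nat)

lemma finite_subset_carrier: "S \<subseteq> carrier G \<Longrightarrow> finite S"
  using finite_carrier finite_subset by blast

lemma finite_subgroup: "subgroup H G \<Longrightarrow> finite H"
  using finite_subset_carrier subgroup.subset by blast

lemma card_subgroup_pos: "subgroup H G \<Longrightarrow> card H > 0"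
  using finite_subgroup subgroup.one_closed card_gt_0_iff by blast

lemma card_subgroup_power:
  assumes "subgroup H G"
  obtains k where "card H = p ^ k"
proof -
  have "card H dvd order G" using lagrange[OF assms] by (metis dvd_triv_right)
  then show ?thesis using that order_power prime divides_primepow_nat by metis
qed

lemma card_proper_subgroup_dvd:
  assumes "subgroup H G" "subgroup K G" "H \<subset> K"
  shows "p * card H dvd card K"
proof -
  obtain a b where ab: "card H = p ^ a" "card K = p ^ b"
    using card_subgroup_power assms by metis
  have "card H < card K" using assms finite_subgroup psubset_card_mono by blast
  then have "Suc a \<le> b" using ab p_gt_1 by (simp add: Suc_le_eq)
  then show ?thesis using ab by (simp add: le_imp_power_dvd flip: power_Suc)
qed

lemma card_proper_subgroup:
  assumes "subgroup H G" "subgroup K G" "H \<subset> K"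
  shows "p * card H \<le> card K"
  using card_proper_subgroup_dvd[OF assms] card_subgroup_pos[OF assms(2)] by (rule dvd_imp_le)

section \<open>Coverings by subgroups, and nilpotency of finite p-groups\<close>

text \<open>A proper subgroup has at most \<open>|G| / p\<close> elements, and all share the
  identity, so \<open>p\<close> of them have at most \<open>1 + p (|G| / p - 1) < |G|\<close>
  elements together. Allowing \<open>p\<close> subgroups leaves room for one besides the given
  \<open>p - 1\<close>.\<close>

lemma subgroups_not_cover:
  assumes "finite I" "card I \<le> p" "\<And>i. i \<in> I \<Longrightarrow> subgroup (H i) G \<and> H i \<noteq> carrier G"
  shows "\<exists>x\<in>carrier G. \<forall>i\<in>I. x \<notin> H i"
proof (rule ccontr)
  assume "\<not> ?thesis"
  then have cov: "carrier G \<subseteq> (\<Union>i\<in>I. H i)" by auto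
  have H: "p * card (H i) \<le> card (carrier G)" "card (H i) > 0" "finite (H i)" if "i \<in> I" for i
    using card_proper_subgroup[of "H i" "carrier G"] assms(3)[OF that] subgroup.subset[of "H i" G]
      subgroup_self card_subgroup_pos finite_subgroup by auto
  obtain i0 where i0: "i0 \<in> I" using cov one_closed by auto
  let ?g = "card (carrier G)"
  have g: "?g \<ge> p" using H[OF i0] by (metis One_nat_def Suc_leI le_trans mult.right_neutral mult_le_mono2)
  have "carrier G \<subseteq> insert \<one> (\<Union>i\<in>I. H i - {\<one>})" using cov by auto
  then have "?g \<le> card (insert \<one> (\<Union>i\<in>I. H i - {\<one>}))"
    using assms(1) H(3) by (intro card_mono) auto
  also have "\<dots> \<le> Suc (card (\<Union>i\<in>I. H i - {\<one>}))" by (rule card_insert_le_m1) auto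
  also have "\<dots> \<le> Suc (\<Sum>i\<in>I. card (H i - {\<one>}))"
    using card_UN_le[OF assms(1), of "\<lambda>i. H i - {\<one>}"] by simp
  finally have "p * ?g \<le> p + (\<Sum>i\<in>I. p * card (H i - {\<one>}))"
    by (metis mult_Suc_right mult_le_mono2 sum_distrib_left)
  also have "(\<Sum>i\<in>I. p * card (H i - {\<one>})) \<le> (\<Sum>i\<in>I. ?g - p)"
  proof (rule sum_mono)
    fix i assume i: "i \<in> I"
    then have "card (H i - {\<one>}) = card (H i) - 1"
      using assms(3) subgroup.one_closed H(3) by (metis card_Diff_singleton)
    then show "p * card (H i - {\<one>}) \<le> ?g - p" using H(1)[OF i] by (simp add: diff_mult_distrib2)
  qed
  also have "\<dots> \<le> p * (?g - p)" using assms(2) by simp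
  also have "p + p * (?g - p) < p * ?g"
  proof -
    obtain r where "?g = p + r" using g le_Suc_ex by blast
    moreover have "p * 1 < p * p" using p_gt_1 by (intro mult_strict_left_mono) auto
    ultimately show ?thesis by (simp add: distrib_left)
  qed
  finally show False by simp
qed

text \<open>The class equation for conjugation on \<open>D / K\<close>, carried out in
  \<open>G\<close>. If nothing outside \<open>K\<close> were central modulo \<open>K\<close>, all
  classes in \<open>D - K\<close> would have size divisible by \<open>p * card K\<close>; as this
  number divides \<open>card D\<close>, it would divide \<open>card K\<close>.\<close>

lemma exists_central_mod:
  assumes K: "K \<lhd> G" and D: "D \<lhd> G" and KD: "K \<subset> D"
  shows "\<exists>d\<in>D - K. \<forall>g\<in>carrier G. com G d g \<in> K"
proof (rule ccontr)
  assume *: "\<not> ?thesis"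
  interpret K: normal K G by fact
  interpret D: normal D G by fact
  have DG: "D \<subseteq> carrier G" by (rule D.subset)
  let ?S = "D - K"
  let ?conj = "\<lambda>g d. g \<otimes> d \<otimes> inv g"
  \<comment> \<open>The relation is conjugacy modulo \<open>K\<close>.\<close>
  define r where "r = {(d, d'). d \<in> ?S \<and> d' \<in> ?S \<and> (\<exists>g\<in>carrier G. d' \<otimes> inv (?conj g d) \<in> K)}"
  have "equiv ?S r"
  proof (rule equivI)
    show "r \<subseteq> ?S \<times> ?S" by (auto simp: r_def)
    show "refl_on ?S r"
      using DG K.one_closed by (auto simp: refl_on_def r_def intro!: bexI[of _ \<one>])
    show "sym r"
    proof (rule symI)
      fix d d' assume "(d, d') \<in> r"
      then obtain g where g: "d \<in> ?S" "d' \<in> ?S" "g \<in> carrier G" "d' \<otimes> inv (?conj g d) \<in> K"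
        by (auto simp: r_def)
      have c: "d \<in> carrier G" "d' \<in> carrier G" using g DG by auto
      have "inv g \<otimes> inv (d' \<otimes> inv (?conj g d)) \<otimes> g \<in> K"
        using K.inv_op_closed1[OF g(3) K.m_inv_closed[OF g(4)]] .
      moreover have "inv g \<otimes> inv (d' \<otimes> inv (?conj g d)) \<otimes> g = d \<otimes> inv (?conj (inv g) d')"
        using g(3) c by (simp add: word_simps)
      ultimately show "(d', d) \<in> r" using g by (auto simp: r_def intro!: bexI[of _ "inv g"])
    qed
    show "trans r"
    proof (rule transI)
      fix d d' d'' assume "(d, d') \<in> r" "(d', d'') \<in> r"
      then obtain g h where g: "d \<in> ?S" "d' \<in> ?S" "d'' \<in> ?S" "g \<in> carrier G" "h \<in> carrier G"
        "d' \<otimes> inv (?conj g d) \<in> K" "d'' \<otimes> inv (?conj h d') \<in> K"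
        by (auto simp: r_def)
      have c: "d \<in> carrier G" "d' \<in> carrier G" "d'' \<in> carrier G" using g DG by auto
      have "d'' \<otimes> inv (?conj h d') \<otimes> (?conj h (d' \<otimes> inv (?conj g d))) \<in> K"
        using K.m_closed[OF g(7) K.inv_op_closed2[OF g(5,6)]] .
      moreover have "d'' \<otimes> inv (?conj h d') \<otimes> (?conj h (d' \<otimes> inv (?conj g d)))
        = d'' \<otimes> inv (?conj (h \<otimes> g) d)"
        using g(4,5) c by (simp add: word_simps)
      ultimately show "(d, d'') \<in> r" using g by (auto simp: r_def intro!: bexI[of _ "h \<otimes> g"])
    qed
  qed
  moreover have "p * card K dvd card C" if "C \<in> ?S // r" for C
  proof -
    obtain d where d: "d \<in> ?S" "C = r `` {d}" using \<open>C \<in> ?S // r\<close> by (auto simp: quotient_def)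
    then have dc: "d \<in> carrier G" using DG by auto
    \<comment> \<open>The stabilizer of the coset of \<open>d\<close>; it is proper because
      \<open>d\<close> is not central modulo \<open>K\<close>.\<close>
    define T where "T = {g \<in> carrier G. \<forall>x\<in>{d}. com G x g \<in> K}"
    have T: "subgroup T G" unfolding T_def by (rule subgroup_com_left[OF K]) (use dc in simp)
    have "T \<noteq> carrier G" using * d(1) by (auto simp: T_def)
    then have TG: "T \<subset> carrier G" using subgroup.subset[OF T] by blast
    obtain q where q: "order G = p * card T * q"
      using card_proper_subgroup_dvd[OF T subgroup_self TG] by (auto simp: order_def)
    have C: "c \<in> C \<longleftrightarrow> c \<in> carrier G \<and> (\<exists>g\<in>carrier G. c \<otimes> inv (?conj g d) \<in> K)" for c
    proof
      assume "c \<in> carrier G \<and> (\<exists>g\<in>carrier G. c \<otimes> inv (?conj g d) \<in> K)"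
      then obtain g where g: "c \<in> carrier G" "g \<in> carrier G" "c \<otimes> inv (?conj g d) \<in> K" by blast
      have dD: "d \<in> D" using d by simp
      have ceq: "c = (c \<otimes> inv (?conj g d)) \<otimes> ?conj g d" using g dc by (simp add: word_simps)
      have "c \<in> D"
        using D.m_closed[OF subsetD[OF _ g(3)] D.inv_op_closed2[OF g(2) dD]] KD ceq by auto
      moreover have "c \<notin> K"
      proof
        assume "c \<in> K"
        then have "inv g \<otimes> (inv (c \<otimes> inv (?conj g d)) \<otimes> c) \<otimes> g \<in> K"
          using K.inv_op_closed1[OF g(2) K.m_closed[OF K.m_inv_closed[OF g(3)]]] by blast
        moreover have "inv g \<otimes> (inv (c \<otimes> inv (?conj g d)) \<otimes> c) \<otimes> g = d"
          using g dc by (simp add: word_simps)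
        ultimately show False using d by simp
      qed
      ultimately show "c \<in> C" using d g by (auto simp: r_def)
    qed (use d DG in \<open>auto simp: r_def\<close>)
    then obtain s where s: "\<And>c. c \<in> C \<Longrightarrow> s c \<in> carrier G \<and> c \<otimes> inv (?conj (s c) d) \<in> K"
      by metis
    have CG: "C \<subseteq> carrier G" using C by blast
    \<comment> \<open>Orbit and stabilizer are counted by a bijection of \<open>C \<times> T\<close>
      with \<open>K \<times> carrier G\<close>. Here \<open>s c\<close> conjugates \<open>d\<close>
      to \<open>c\<close> modulo \<open>K\<close>; the pair \<open>(c, t)\<close> goes to the
      conjugating element \<open>s c \<otimes> t\<close> and the discrepancy in
      \<open>K\<close>.\<close>
    define \<phi> where "\<phi> = (\<lambda>(c, t). (c \<otimes> inv (?conj (s c \<otimes> t) d), s c \<otimes> t))"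
    define \<psi> where "\<psi> = (\<lambda>(k, g). (k \<otimes> ?conj g d, inv (s (k \<otimes> ?conj g d)) \<otimes> g))"
    have C_left: "c \<in> carrier G" "t \<in> carrier G" "s c \<in> carrier G" "c \<otimes> inv (?conj (s c) d) \<in> K"
      "com G d t \<in> K" if "(c, t) \<in> C \<times> T" for c t
      using that CG TG s by (auto simp: T_def)
    have C_right: "k \<in> carrier G" "g \<in> carrier G" "k \<otimes> ?conj g d \<in> C"
      "k \<otimes> ?conj g d \<otimes> inv (?conj g d) = k" if "(k, g) \<in> K \<times> carrier G" for k g
    proof -
      show kg: "k \<in> carrier G" "g \<in> carrier G" using that K.subset by auto
      show e: "k \<otimes> ?conj g d \<otimes> inv (?conj g d) = k" using kg dc by (simp add: word_simps)
      have "k \<otimes> ?conj g d \<in> carrier G" using kg dc by simp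
      then show "k \<otimes> ?conj g d \<in> C" using C kg that e by (metis mem_Sigma_iff)
    qed
    have "bij_betw \<phi> (C \<times> T) (K \<times> carrier G)"
    proof (rule bij_betw_byWitness[where f' = \<psi>])
      show "\<forall>a\<in>C \<times> T. \<psi> (\<phi> a) = a"
      proof
        fix a assume a: "a \<in> C \<times> T"
        obtain c t where ct: "a = (c, t)" by fastforce
        note cc = C_left[OF a[unfolded ct]]
        have "c \<otimes> inv (?conj (s c \<otimes> t) d) \<otimes> ?conj (s c \<otimes> t) d = c"
          using cc dc by (simp add: word_simps)
        then show "\<psi> (\<phi> a) = a"
          using cc dc by (simp add: cancel_left2 \<phi>_def \<psi>_def ct)
      qed
      show "\<forall>a\<in>K \<times> carrier G. \<phi> (\<psi> a) = a"
      proof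
        fix a assume a: "a \<in> K \<times> carrier G"
        obtain k g where kg: "a = (k, g)" by fastforce
        note kc = C_right[OF a[unfolded kg]]
        have "s (k \<otimes> ?conj g d) \<otimes> (inv (s (k \<otimes> ?conj g d)) \<otimes> g) = g"
          using s[OF kc(3)] kc(2) by (simp add: cancel_left1)
        then show "\<phi> (\<psi> a) = a" using kc(4) by (simp add: \<phi>_def \<psi>_def kg)
      qed
      show "\<phi> ` (C \<times> T) \<subseteq> K \<times> carrier G"
      proof
        fix a assume "a \<in> \<phi> ` (C \<times> T)"
        then obtain c t where ct: "(c, t) \<in> C \<times> T" "a = \<phi> (c, t)" by auto
        note cc = C_left[OF ct(1)]
        have "c \<otimes> inv (?conj (s c) d) \<otimes> ?conj (s c) (com G d t) \<in> K"
          using K.m_closed[OF cc(4) K.inv_op_closed2[OF cc(3,5)]] .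
        moreover have "c \<otimes> inv (?conj (s c) d) \<otimes> ?conj (s c) (com G d t)
          = c \<otimes> inv (?conj (s c \<otimes> t) d)"
          using cc dc by (simp add: com_def word_simps)
        ultimately show "a \<in> K \<times> carrier G" using cc ct by (simp add: \<phi>_def)
      qed
      show "\<psi> ` (K \<times> carrier G) \<subseteq> C \<times> T"
      proof
        fix a assume "a \<in> \<psi> ` (K \<times> carrier G)"
        then obtain k g where kg: "(k, g) \<in> K \<times> carrier G" "a = \<psi> (k, g)" by auto
        note kc = C_right[OF kg(1)]
        let ?c = "k \<otimes> ?conj g d"
        have cc: "?c \<in> carrier G" using kc(3) CG by blast
        have sc: "s ?c \<in> carrier G" "?c \<otimes> inv (?conj (s ?c) d) \<in> K" using s[OF kc(3)] by auto
        have gen: "inv v \<otimes> (inv (c \<otimes> inv (?conj v d)) \<otimes> (c \<otimes> inv (?conj g d))) \<otimes> v = com G d (inv v \<otimes> g)"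
          if "c \<in> carrier G" "v \<in> carrier G" for c v
          using that kc(2) dc by (simp add: com_def word_simps)
        have "?c \<otimes> inv (?conj g d) \<in> K" using kc(4) kg(1) by simp
        from K.inv_op_closed1[OF sc(1) K.m_closed[OF K.m_inv_closed[OF sc(2)] this]]
        have "com G d (inv (s ?c) \<otimes> g) \<in> K" using gen[OF cc sc(1)] by simp
        then show "a \<in> C \<times> T" using kc sc kg by (simp add: T_def \<psi>_def)
      qed
    qed
    then have "card (C \<times> T) = card (K \<times> carrier G)" by (rule bij_betw_same_card)
    then have "card C * card T = (p * card K * q) * card T"
      using q by (simp add: card_cartesian_product order_def ac_simps)
    then show ?thesis using card_subgroup_pos[OF T] by simp
  qed
  ultimately have "p * card K dvd card ?S"
    using equiv_imp_dvd_card[of ?S r "p * card K"] finite_subset_carrier DG by blast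
  moreover have "card ?S = card D - card K"
    using KD finite_subset_carrier DG by (intro card_Diff_subset) (auto intro: finite_subset)
  moreover have "p * card K dvd card D"
    using card_proper_subgroup_dvd K D normal_imp_subgroup KD by blast
  moreover have "card K \<le> card D" using KD finite_subset_carrier DG by (intro card_mono) auto
  ultimately have "p * card K dvd card K" by (metis dvd_diffD1)
  moreover have "card K > 0" using card_subgroup_pos K normal_imp_subgroup by blast
  ultimately show False using p_gt_1 dvd_imp_le[of "p * card K" "card K"] by simp
qed

text \<open>A term \<open>D\<close> of least order satisfies \<open>[D, G] = D\<close>. If
  \<open>D\<close> were nontrivial, let \<open>K\<close> be normal in \<open>G\<close> and of
  largest order properly inside \<open>D\<close>. The elements of \<open>D\<close> central modulo
  \<open>K\<close> form a larger normal subgroup, hence all of \<open>D\<close>, and so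
  \<open>D = [D, G]\<close> would lie in \<open>K\<close>.\<close>

lemma lcs_trivial: "\<exists>m. lcs G m = {\<one>}"
proof -
  obtain m where m: "\<And>k. card (lcs G m) \<le> card (lcs G k)"
    using ex_has_least_nat[of "\<lambda>_. True" 0 "\<lambda>k. card (lcs G k)"] by auto
  let ?D = "lcs G m"
  have stable: "lcs G (Suc m) = ?D"
    using card_seteq[OF finite_subgroup[OF lcs_subgroup] lcs_Suc_le m] .
  have "?D = {\<one>}"
  proof (rule ccontr)
    assume D1: "?D \<noteq> {\<one>}"
    let ?P = "\<lambda>K. K \<lhd> G \<and> K \<subset> ?D"
    have "?P {\<one>}" using D1 one_is_normal subgroup.one_closed[OF lcs_subgroup] by blast
    moreover have "card K < Suc (card ?D)" if "?P K" for K
      using that finite_subgroup[OF lcs_subgroup] by (meson card_mono less_Suc_eq_le psubset_imp_subset)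
    ultimately obtain K where K: "?P K" "\<And>E. ?P E \<Longrightarrow> card E \<le> card K"
      using ex_has_greatest_nat[of ?P "{\<one>}" card "Suc (card ?D)"] by auto
    obtain d where d: "d \<in> ?D" "d \<notin> K" "\<forall>g\<in>carrier G. com G d g \<in> K"
      using exists_central_mod[OF _ lcs_normal, of K m] K(1) by blast
    interpret K: normal K G using K by blast
    interpret D: normal ?D G by (rule lcs_normal)
    define E where "E = ?D \<inter> {y \<in> carrier G. \<forall>x\<in>carrier G. com G x y \<in> K}"
    have "subgroup E G" unfolding E_def
      using subgroups_Inter_pair[OF lcs_subgroup subgroup_com_left[OF K.normal_axioms order_refl]] .
    moreover have "x \<otimes> y \<otimes> inv x \<in> E" if x: "x \<in> carrier G" and y: "y \<in> E" for x y
    proof -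
      have yc: "y \<in> ?D" "y \<in> carrier G" "\<And>g. g \<in> carrier G \<Longrightarrow> com G g y \<in> K"
        using y by (auto simp: E_def)
      have "com G g (x \<otimes> y \<otimes> inv x) \<in> K" if g: "g \<in> carrier G" for g
      proof -
        have "com G g (x \<otimes> y \<otimes> inv x) = x \<otimes> com G (inv x \<otimes> g \<otimes> x) y \<otimes> inv x"
          using x yc g by (simp add: com_def word_simps)
        then show ?thesis using K.inv_op_closed2[OF x yc(3)] x g by simp
      qed
      then show ?thesis using D.inv_op_closed2[OF x yc(1)] x yc by (simp add: E_def)
    qed
    ultimately have E: "E \<lhd> G" using normal_inv_iff by blast
    have "K \<subseteq> E"
    proof
      fix k assume k: "k \<in> K"
      have kc: "k \<in> carrier G" using k K.subset by blast
      have "com G x k \<in> K" if "x \<in> carrier G" for x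
        using com_swap_mem[OF K.subgroup_axioms kc that com_normal_left[OF K.normal_axioms k that]] .
      then show "k \<in> E" using k K(1) kc by (auto simp: E_def)
    qed
    moreover have "d \<in> E"
      using d D.subset com_swap_mem[OF K.subgroup_axioms] by (auto simp: E_def)
    ultimately have "card K < card E"
      using d finite_subgroup[OF normal_imp_subgroup[OF E]] by (intro psubset_card_mono) auto
    then have "E = ?D" using K(2)[of E] E by (force simp: E_def)
    then have "com G g x \<in> K" if "g \<in> ?D" "x \<in> carrier G" for g x
      using that com_swap_mem[OF K.subgroup_axioms] D.subset by (auto simp: E_def)
    then have "lcs G (Suc m) \<subseteq> K"
      unfolding lcs.simps by (intro generate_subgroup_incl K.subgroup_axioms) auto
    then show False using stable K(1) by blast
  qed
  then show ?thesis by blast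
qed

end

section \<open>The Lie ring of the lower central series\<close>

lemma aspan_additive:
  assumes "add_sub T" "\<And>x y. f (x - y) = f x - f y" "\<And>s. s \<in> S \<Longrightarrow> f s \<in> T" "x \<in> aspan S"
  shows "f x \<in> T"
proof -
  have "f 0 = 0" using assms(2)[of 0 0] by simp
  then have "add_sub {x. f x \<in> T}" using assms(1,2) by (simp add: add_sub_def)
  then show ?thesis using aspan_least[of "{x. f x \<in> T}" S] assms(3,4) by auto
qed

lemma aspan_biadditive:
  assumes "add_sub T" "\<And>x y z. f (x - y) z = f x z - f y z" "\<And>x y z. f z (x - y) = f z x - f z y"
    and "\<And>s t. s \<in> S \<Longrightarrow> t \<in> S' \<Longrightarrow> f s t \<in> T" "x \<in> aspan S" "y \<in> aspan S'"
  shows "f x y \<in> T"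
proof (rule aspan_additive[where f = "\<lambda>x. f x y", OF assms(1,2) _ assms(5)])
  fix s assume "s \<in> S"
  then show "f s y \<in> T"
    by (rule aspan_additive[where f = "f s", OF assms(1,3) assms(4) assms(6)])
qed

text \<open>The basis elements of a free abelian group whose members are integer-valued
  functions.\<close>

definition delta :: "'a \<Rightarrow> 'a \<Rightarrow> int" where
  "delta g h = of_bool (h = g)"

text \<open>This prepares the homomorphism from the free abelian group that extends
  \<open>c\<close>; it is used in \<open>delta_mem_NN_iff\<close>.\<close>

lemma (in comm_group) formal_product:
  fixes u v :: "'c \<Rightarrow> int"
  assumes S: "finite S" "\<And>x. x \<in> S \<Longrightarrow> c x \<in> carrier G"
  shows "(\<Otimes>x\<in>S. c x [^] u x) \<in> carrier G"
    and "(\<Otimes>x\<in>S. c x [^] (u + v) x) = (\<Otimes>x\<in>S. c x [^] u x) \<otimes> (\<Otimes>x\<in>S. c x [^] v x)"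
    and "a \<in> S \<Longrightarrow> (\<Otimes>x\<in>S. c x [^] delta a x) = c a"
proof -
  show "(\<Otimes>x\<in>S. c x [^] u x) \<in> carrier G" using S by (intro finprod_closed) auto
  have "(\<Otimes>x\<in>S. c x [^] (u + v) x) = (\<Otimes>x\<in>S. c x [^] u x \<otimes> c x [^] v x)"
    using S by (intro finprod_cong') (auto simp: int_pow_mult)
  then show "(\<Otimes>x\<in>S. c x [^] (u + v) x) = (\<Otimes>x\<in>S. c x [^] u x) \<otimes> (\<Otimes>x\<in>S. c x [^] v x)"
    using S by (simp add: finprod_multf Pi_def)
  assume a: "a \<in> S"
  have "(\<Otimes>x\<in>S. c x [^] delta a x) = (\<Otimes>x\<in>S. if a = x then c x else \<one>)"
    using S by (intro finprod_cong') (auto simp: delta_def int_pow_1)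
  also have "\<dots> = c a" using S by (intro finprod_singleton[OF a]) auto
  finally show "(\<Otimes>x\<in>S. c x [^] delta a x) = c a" .
qed

text \<open>The quotient of \<open>lcs G d\<close> by \<open>lcs G (Suc d)\<close>, written additively: the free abelian group on
  \<open>lcs G d\<close> modulo the subgroup \<open>NN d\<close> of relations. The commutator induces the bracket \<open>BR\<close>.\<close>

context finite_p_group
begin

definition LL :: "nat \<Rightarrow> ('a \<Rightarrow> int) set" where
  "LL d = aspan (delta ` lcs G d)"

definition rels :: "nat \<Rightarrow> ('a \<Rightarrow> int) set" where
  "rels d = {delta (g \<otimes> h) - delta g - delta h |g h. g \<in> lcs G d \<and> h \<in> lcs G d}
    \<union> delta ` lcs G (Suc d)"

definition NN :: "nat \<Rightarrow> ('a \<Rightarrow> int) set" where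
  "NN d = aspan (rels d)"

text \<open>The bilinear extension of the commutator from basis elements. It is defined on all
  functions, so that additivity holds without membership conditions; the sums are finite because
  \<open>G\<close> is.\<close>

definition BR :: "('a \<Rightarrow> int) \<Rightarrow> ('a \<Rightarrow> int) \<Rightarrow> 'a \<Rightarrow> int" where
  "BR u v k = (\<Sum>g\<in>carrier G. \<Sum>h\<in>carrier G. of_bool (com G g h = k) * (u g * v h))"

lemma BR_add_left: "BR (u + u') v = BR u v + BR u' v"
  by (rule ext) (simp add: BR_def algebra_simps sum.distrib)

lemma BR_add_right: "BR v (u + u') = BR v u + BR v u'"
  by (rule ext) (simp add: BR_def algebra_simps sum.distrib)

lemma BR_diff_left: "BR (u - u') v = BR u v - BR u' v"
  using BR_add_left[of "u - u'" u' v] by (simp add: algebra_simps)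

lemma BR_diff_right: "BR v (u - u') = BR v u - BR v u'"
  using BR_add_right[of v "u - u'" u'] by (simp add: algebra_simps)

lemma BR_delta:
  assumes "a \<in> carrier G" "b \<in> carrier G"
  shows "BR (delta a) (delta b) = delta (com G a b)"
proof
  fix k
  have "(\<Sum>h\<in>carrier G. of_bool (com G g h = k) * (delta a g * delta b h))
    = (if g = a then of_bool (com G a b = k) else 0)" for g
  proof -
    have "(\<Sum>h\<in>carrier G. of_bool (com G g h = k) * (delta a g * delta b h))
      = (\<Sum>h\<in>carrier G. if h = b then of_bool (com G g b = k) * delta a g else 0)"
      by (rule sum.cong) (auto simp: delta_def)
    then show ?thesis using assms finite_carrier by (simp add: delta_def)
  qed
  then have "BR (delta a) (delta b) k = (\<Sum>g\<in>carrier G. if g = a then of_bool (com G a b = k) else 0)"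
    unfolding BR_def by (intro sum.cong refl)
  also have "\<dots> = delta (com G a b) k"
    using assms finite_carrier by (auto simp: delta_def)
  finally show "BR (delta a) (delta b) k = delta (com G a b) k" .
qed

lemma lcs_carrier: "g \<in> lcs G d \<Longrightarrow> g \<in> carrier G"
  using lcs_le_carrier by blast

lemma lcs_closed: "g \<in> lcs G d \<Longrightarrow> h \<in> lcs G d \<Longrightarrow> g \<otimes> h \<in> lcs G d"
  "g \<in> lcs G d \<Longrightarrow> inv g \<in> lcs G d" "\<one> \<in> lcs G d"
  using lcs_subgroup by (auto intro: subgroup.m_closed subgroup.m_inv_closed subgroup.one_closed)

lemma sub_LL: "add_sub (LL d)" and sub_NN: "add_sub (NN d)"
  by (simp_all add: LL_def NN_def add_sub_aspan)

lemma delta_mem_LL: "g \<in> lcs G d \<Longrightarrow> delta g \<in> LL d"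
  by (simp add: LL_def aspan.base)

lemma delta_mult: "g \<in> lcs G d \<Longrightarrow> h \<in> lcs G d \<Longrightarrow> delta (g \<otimes> h) - delta g - delta h \<in> NN d"
  unfolding NN_def rels_def by (rule aspan.base) blast

lemma delta_mem_NN: "g \<in> lcs G (Suc d) \<Longrightarrow> delta g \<in> NN d"
  unfolding NN_def rels_def by (rule aspan.base) blast

lemma delta_inv: "g \<in> lcs G d \<Longrightarrow> delta (inv g) + delta g \<in> NN d"
proof -
  assume g: "g \<in> lcs G d"
  have "delta \<one> - (delta (inv g \<otimes> g) - delta (inv g) - delta g) \<in> NN d"
    using add_sub_diff[OF sub_NN delta_mem_NN[OF lcs_closed(3)] delta_mult] g lcs_closed by blast
  then show ?thesis using lcs_carrier[OF g] by (simp add: algebra_simps)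
qed

lemma delta_div: "g \<in> lcs G d \<Longrightarrow> h \<in> lcs G d \<Longrightarrow> delta g - delta h - delta (g \<otimes> inv h) \<in> NN d"
proof -
  assume g: "g \<in> lcs G d" "h \<in> lcs G d"
  have "delta (g \<otimes> inv h \<otimes> h) - delta (g \<otimes> inv h) - delta h \<in> NN d"
    by (rule delta_mult[OF lcs_closed(1)[OF g(1) lcs_closed(2)[OF g(2)]] g(2)])
  moreover have "g \<otimes> inv h \<otimes> h = g" using g lcs_carrier by (simp add: word_simps)
  ultimately show ?thesis by (simp add: algebra_simps)
qed

lemma delta_cong: "g \<in> lcs G d \<Longrightarrow> h \<in> lcs G d \<Longrightarrow> g \<otimes> inv h \<in> lcs G (Suc d) \<Longrightarrow>
  delta g - delta h \<in> NN d"
  using delta_div delta_mem_NN add_sub_diff_iff[OF sub_NN] by blast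

lemma NN_le_LL: "NN d \<subseteq> LL d"
  unfolding NN_def
proof (rule aspan_least[OF sub_LL])
  have "delta (g \<otimes> h) - delta g - delta h \<in> LL d" if "g \<in> lcs G d" "h \<in> lcs G d" for g h
    using that by (intro add_sub_diff[OF sub_LL] delta_mem_LL lcs_closed)
  then show "rels d \<subseteq> LL d"
    using delta_mem_LL subsetD[OF lcs_Suc_le] by (auto simp: rels_def)
qed

text \<open>Modulo the relations a difference of basis elements collapses to a single one, so every
  class is represented by a group element.\<close>

lemma LL_rep:
  assumes "u \<in> LL d"
  shows "\<exists>g\<in>lcs G d. u - delta g \<in> NN d"
  using assms unfolding LL_def
proof induction
  case zero
  have "0 - delta \<one> \<in> NN d"
    using add_sub_diff[OF sub_NN add_sub_zero[OF sub_NN] delta_mem_NN[OF lcs_closed(3)]] .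
  then show ?case using lcs_closed(3) by blast
next
  case (base x)
  then obtain g where g: "g \<in> lcs G d" "x = delta g" by blast
  have "x - delta g \<in> NN d" unfolding g(2) diff_self by (rule add_sub_zero[OF sub_NN])
  then show ?case using g(1) by blast
next
  case (diff x y)
  then obtain g h where g: "g \<in> lcs G d" "x - delta g \<in> NN d" "h \<in> lcs G d" "y - delta h \<in> NN d"
    by blast
  have "(x - delta g) - (y - delta h) + (delta g - delta h - delta (g \<otimes> inv h)) \<in> NN d"
    by (intro add_sub_add[OF sub_NN] add_sub_diff[OF sub_NN] g delta_div)
  then have "x - y - delta (g \<otimes> inv h) \<in> NN d" by (simp add: algebra_simps)
  then show ?case using g lcs_closed by blast
qed

lemma BR_LL: "u \<in> LL i \<Longrightarrow> v \<in> LL j \<Longrightarrow> BR u v \<in> LL (Suc (i + j))"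
  unfolding LL_def[of i] LL_def[of j]
proof (rule aspan_biadditive[where f = BR, OF sub_LL BR_diff_left BR_diff_right])
  fix s t assume "s \<in> delta ` lcs G i" "t \<in> delta ` lcs G j"
  then show "BR s t \<in> LL (Suc (i + j))"
    using com_lcs lcs_carrier by (auto simp: BR_delta delta_mem_LL)
qed

text \<open>By \<open>com_mult_left\<close>, \<open>[x y, h]\<close> is the product of
  \<open>[y, h]\<close> and \<open>[x, h]\<close> up to \<open>[x, [y, h]]\<close>, which lies
  deeper in the series.\<close>

lemma BR_NN_left: "u \<in> NN i \<Longrightarrow> v \<in> LL j \<Longrightarrow> BR u v \<in> NN (Suc (i + j))"
  unfolding NN_def[of i] LL_def[of j]
proof (rule aspan_biadditive[where f = BR, OF sub_NN BR_diff_left BR_diff_right])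
  fix s t assume s: "s \<in> rels i" and t: "t \<in> delta ` lcs G j"
  obtain h where h: "h \<in> lcs G j" "t = delta h" using t by blast
  have "BR (delta (x \<otimes> y) - delta x - delta y) t \<in> NN (Suc (i + j))"
    if xy: "x \<in> lcs G i" "y \<in> lcs G i" for x y
  proof -
    note c = lcs_carrier[OF xy(1)] lcs_carrier[OF xy(2)] lcs_carrier[OF h(1)]
    let ?a = "com G x (com G y h)" and ?b = "com G y h" and ?c = "com G x h"
    have b: "?b \<in> lcs G (Suc (i + j))" "?c \<in> lcs G (Suc (i + j))" using com_lcs xy h by auto
    have a: "?a \<in> lcs G (Suc (Suc (i + j)))"
      using com_lcs[OF xy(1) b(1)] lcs_antimono[of "Suc (Suc (i + j))" "Suc (i + Suc (i + j))"] by auto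
    then have a': "?a \<in> lcs G (Suc (i + j))" using lcs_Suc_le by blast
    have "(delta (?a \<otimes> ?b \<otimes> ?c) - delta (?a \<otimes> ?b) - delta ?c)
      + (delta (?a \<otimes> ?b) - delta ?a - delta ?b) + delta ?a \<in> NN (Suc (i + j))"
      by (intro add_sub_add[OF sub_NN] delta_mult delta_mem_NN lcs_closed a a' b)
    then show ?thesis using c by (simp add: BR_diff_left BR_delta h(2) com_mult_left BR_add_left algebra_simps)
  qed
  moreover have "BR (delta k) t \<in> NN (Suc (i + j))" if k: "k \<in> lcs G (Suc i)" for k
    using com_lcs[OF k h(1)] k h lcs_carrier by (simp add: BR_delta delta_mem_NN)
  ultimately show "BR s t \<in> NN (Suc (i + j))" using s by (auto simp: rels_def)
qed

lemma BR_antisym: "u \<in> LL i \<Longrightarrow> v \<in> LL j \<Longrightarrow> BR u v + BR v u \<in> NN (Suc (i + j))"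
  unfolding LL_def[of i] LL_def[of j]
proof (rule aspan_biadditive[OF sub_NN, where f = "\<lambda>u v. BR u v + BR v u"])
  fix s t assume "s \<in> delta ` lcs G i" "t \<in> delta ` lcs G j"
  then obtain g h where g: "g \<in> lcs G i" "s = delta g" "h \<in> lcs G j" "t = delta h" by blast
  then have "inv (com G g h) = com G h g" using inv_com lcs_carrier by blast
  then show "BR s t + BR t s \<in> NN (Suc (i + j))"
    using delta_inv[OF com_lcs[OF g(1,3)]] g lcs_carrier by (simp add: BR_delta add.commute)
qed (simp_all add: BR_diff_left BR_diff_right)

lemma BR_NN_right: "u \<in> LL i \<Longrightarrow> v \<in> NN j \<Longrightarrow> BR u v \<in> NN (Suc (i + j))"
  using BR_antisym[of u i v j] BR_NN_left[of v j u i] NN_le_LL[of j] sub_NN add_sub_sum_iff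
  by (metis add.commute subsetD)

lemma BR_alt: "u \<in> LL 0 \<Longrightarrow> BR u u \<in> NN 1"
proof -
  assume u: "u \<in> LL 0"
  then obtain g where g: "g \<in> lcs G 0" "u - delta g \<in> NN 0" using LL_rep by blast
  have gc: "g \<in> carrier G" using g lcs_carrier by blast
  have "BR (u - delta g) u \<in> NN (Suc (0 + 0))" using BR_NN_left g(2) u by blast
  moreover have "BR (delta g) (u - delta g) \<in> NN (Suc (0 + 0))"
    using BR_NN_right[OF delta_mem_LL[OF g(1)] g(2)] .
  moreover have "BR (delta g) (delta g) \<in> NN (Suc (0 + 0))"
    using gc delta_mem_NN[OF lcs_closed(3)] by (simp add: BR_delta com_self)
  ultimately have "BR (u - delta g) u + BR (delta g) (u - delta g) + BR (delta g) (delta g) \<in> NN (Suc (0 + 0))"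
    by (intro add_sub_add[OF sub_NN])
  then show ?thesis by (simp add: BR_diff_left BR_diff_right)
qed

lemma BR_jacobi:
  assumes "m \<in> LL i" "a \<in> LL 0" "x \<in> LL j"
  shows "BR (BR m a) x - BR m (BR a x) - BR (BR m x) a \<in> NN (Suc (Suc (i + j)))"
  using assms(1) unfolding LL_def
proof (rule aspan_additive[OF sub_NN, where f = "\<lambda>m. BR (BR m a) x - BR m (BR a x) - BR (BR m x) a", rotated 2])
  fix s assume "s \<in> delta ` lcs G i"
  then obtain g where g: "g \<in> lcs G i" "s = delta g" by blast
  show "BR (BR s a) x - BR s (BR a x) - BR (BR s x) a \<in> NN (Suc (Suc (i + j)))"
    using assms(2,3) unfolding LL_def
  proof (rule aspan_biadditive[OF sub_NN, where f = "\<lambda>a x. BR (BR s a) x - BR s (BR a x) - BR (BR s x) a", rotated 3])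
    fix t u assume "t \<in> delta ` lcs G 0" "u \<in> delta ` lcs G j"
    then obtain h k where h: "h \<in> lcs G 0" "t = delta h" "k \<in> lcs G j" "u = delta k" by blast
    note c = lcs_carrier[OF g(1)] lcs_carrier[OF h(1)] lcs_carrier[OF h(3)]
    let ?X = "com G g (com G h k)" and ?Y = "com G h (com G g k)" and ?Z = "com G (com G g h) k"
    let ?d = "Suc (Suc (i + j))"
    have X: "?X \<in> lcs G ?d" using com_lcs[OF g(1) com_lcs[OF h(1,3)]] by simp
    have Y: "?Y \<in> lcs G ?d" using com_lcs[OF h(1) com_lcs[OF g(1) h(3)]] by simp
    have Z: "?Z \<in> lcs G ?d" using com_lcs[OF com_lcs[OF g(1) h(1)] h(3)] by simp
    have "?X \<otimes> inv (?Y \<otimes> ?Z) \<in> lcs G (Suc ?d)"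
      by (rule com_com_lcs_identity[OF g(1) c(2) h(3)])
    from add_sub_add[OF sub_NN add_sub_add[OF sub_NN delta_inv[OF Y]
        delta_cong[OF X lcs_closed(1)[OF Y Z] this]] delta_mult[OF Y Z]]
    have "(delta (inv ?Y) + delta ?Y) + (delta ?X - delta (?Y \<otimes> ?Z))
      + (delta (?Y \<otimes> ?Z) - delta ?Y - delta ?Z) \<in> NN ?d" .
    then have "- (delta (inv ?Y) + delta ?X - delta ?Z) \<in> NN ?d"
      by (intro add_sub_uminus[OF sub_NN]) (simp add: algebra_simps)
    moreover have "inv ?Y = com G (com G g k) h" using c by (simp add: inv_com)
    ultimately show "BR (BR s t) u - BR s (BR t u) - BR (BR s u) t \<in> NN ?d"
      using c by (simp add: BR_delta g(2) h(2,4) algebra_simps)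
  qed (simp_all add: BR_diff_left BR_diff_right)
qed (simp_all add: BR_diff_left BR_diff_right)

lemma LL_generated:
  assumes S: "add_sub S" "NN (Suc d) \<subseteq> S" and br: "\<And>l x. l \<in> LL d \<Longrightarrow> x \<in> LL 0 \<Longrightarrow> BR l x \<in> S"
  shows "LL (Suc d) \<subseteq> S"
proof -
  \<comment> \<open>Membership in \<open>lcs G (Suc d)\<close> is carried along because
    \<open>delta_mult\<close> and \<open>delta_inv\<close> require it.\<close>
  have "g \<in> lcs G (Suc d) \<and> delta g \<in> S" if "g \<in> lcs G (Suc d)" for g
    using that[unfolded lcs.simps(2)]
  proof induction
    case one
    show ?case using lcs_closed(3) delta_mem_NN[OF lcs_closed(3)] S(2) by blast
  next
    case (incl h)
    then obtain g x where g: "h = com G g x" "g \<in> lcs G d" "x \<in> carrier G" by blast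
    then have "delta h = BR (delta g) (delta x)" using lcs_carrier by (simp add: BR_delta)
    then show ?case using br[OF delta_mem_LL delta_mem_LL] g com_mem_lcs_Suc by simp
  next
    case (inv h)
    then obtain g x where g: "h = com G g x" "g \<in> lcs G d" "x \<in> carrier G" by blast
    then have "delta h = BR (delta g) (delta x)" using lcs_carrier by (simp add: BR_delta)
    then have "delta h \<in> S" "h \<in> lcs G (Suc d)" using br[OF delta_mem_LL delta_mem_LL] g com_mem_lcs_Suc by auto
    moreover have "delta (inv h) + delta h \<in> S" using delta_inv S(2) calculation(2) by blast
    ultimately show ?case using add_sub_add_iff'[OF S(1)] lcs_closed by blast
  next
    case (eng g h)
    then have "delta (g \<otimes> h) - delta g - delta h \<in> S" using delta_mult S(2) by blast
    from add_sub_add[OF S(1) add_sub_add[OF S(1) this, of "delta h"], of "delta g"]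
    show ?case using eng lcs_closed by (simp add: algebra_simps)
  qed
  then show ?thesis unfolding LL_def by (intro aspan_least[OF S(1)]) blast
qed

sublocale LR: graded_lie LL NN BR
  by (rule graded_lie.intro)
    (fact sub_LL sub_NN NN_le_LL BR_add_left BR_add_right BR_LL BR_NN_left BR_antisym BR_alt
      BR_jacobi LL_generated)+

lemma comm_group_quotient: "comm_group (G\<lparr>carrier := lcs G d\<rparr> Mod lcs G (Suc d))"
proof -
  let ?K = "G\<lparr>carrier := lcs G d\<rparr>" and ?N = "lcs G (Suc d)"
  interpret N: normal ?N ?K
    by (rule normal_restrict_supergroup[OF lcs_subgroup lcs_normal lcs_Suc_le])
  interpret Q: group "?K Mod ?N" by (rule N.factorgroup_is_group)
  show ?thesis
  proof (rule Q.group_comm_groupI)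
    fix x y assume "x \<in> carrier (?K Mod ?N)" "y \<in> carrier (?K Mod ?N)"
    then obtain g h where g: "g \<in> lcs G d" "x = ?N #>\<^bsub>?K\<^esub> g" "h \<in> lcs G d" "y = ?N #>\<^bsub>?K\<^esub> h"
      by (auto simp: carrier_FactGroup)
    have "g \<otimes> h \<otimes> inv (h \<otimes> g) = com G g h"
      using g lcs_carrier by (simp add: com_def word_simps)
    then have "g \<otimes> h \<otimes> inv (h \<otimes> g) \<in> ?N" using com_mem_lcs_Suc g lcs_carrier by simp
    moreover have "inv\<^bsub>?K\<^esub> (h \<otimes> g) = inv (h \<otimes> g)"
      using m_inv_consistent[OF lcs_subgroup] g lcs_closed by simp
    ultimately have "?N #>\<^bsub>?K\<^esub> (g \<otimes> h) = ?N #>\<^bsub>?K\<^esub> (h \<otimes> g)"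
      using N.coset_eq_iff[of "g \<otimes> h" "h \<otimes> g"] g lcs_closed by simp
    then show "x \<otimes>\<^bsub>?K Mod ?N\<^esub> y = y \<otimes>\<^bsub>?K Mod ?N\<^esub> x"
      using N.coset_mult_FactGroup[of g h] N.coset_mult_FactGroup[of h g] g by simp
  qed
qed

text \<open>Evaluating a formal sum as a product in \<open>lcs G d / lcs G (Suc d)\<close> shows that the relations
  do not collapse this quotient.\<close>

lemma delta_mem_NN_iff:
  assumes "g \<in> lcs G d"
  shows "delta g \<in> NN d \<longleftrightarrow> g \<in> lcs G (Suc d)"
proof
  let ?K = "G\<lparr>carrier := lcs G d\<rparr>" and ?N = "lcs G (Suc d)"
  interpret N: normal ?N ?K
    by (rule normal_restrict_supergroup[OF lcs_subgroup lcs_normal lcs_Suc_le])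
  let ?Q = "?K Mod ?N"
  interpret Q: comm_group ?Q by (rule comm_group_quotient)
  let ?c = "\<lambda>g. ?N #>\<^bsub>?K\<^esub> g"
  have c: "?c x \<in> carrier ?Q" if "x \<in> lcs G d" for x
    using that by (auto simp: carrier_FactGroup)
  have fin: "finite (lcs G d)" using finite_subgroup lcs_subgroup by blast
  define ev where "ev u = finprod ?Q (\<lambda>x. ?c x [^]\<^bsub>?Q\<^esub> (u x :: int)) (lcs G d)" for u
  have ev_closed: "ev u \<in> carrier ?Q" for u
    unfolding ev_def by (rule Q.formal_product(1)[OF fin c])
  have ev_add: "ev (u + v) = ev u \<otimes>\<^bsub>?Q\<^esub> ev v" for u v
    unfolding ev_def by (rule Q.formal_product(2)[OF fin c])
  have ev_delta: "ev (delta a) = ?c a" if "a \<in> lcs G d" for a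
    unfolding ev_def by (rule Q.formal_product(3)[OF fin c that])
  have ev_zero: "ev 0 = \<one>\<^bsub>?Q\<^esub>"
    using ev_add[of 0 0] ev_closed by (metis Q.l_cancel_one' add_0)
  have ev_diff: "ev (u - v) = \<one>\<^bsub>?Q\<^esub> \<longleftrightarrow> ev u = ev v" for u v
    using ev_add[of "u - v" v] ev_closed by (metis Q.l_cancel_one Q.r_cancel_one diff_add_cancel Q.m_comm)
  have c_one: "?c x = \<one>\<^bsub>?Q\<^esub> \<longleftrightarrow> x \<in> ?N" if "x \<in> lcs G d" for x
    using N.coset_eq_one_iff that by simp
  have "add_sub {u. ev u = \<one>\<^bsub>?Q\<^esub>}"
    using ev_zero ev_diff by (auto simp: add_sub_def)
  moreover have "rels d \<subseteq> {u. ev u = \<one>\<^bsub>?Q\<^esub>}"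
  proof -
    have "ev (delta (x \<otimes> y) - delta x - delta y) = \<one>\<^bsub>?Q\<^esub>" if xy: "x \<in> lcs G d" "y \<in> lcs G d" for x y
    proof -
      have "ev (delta (x \<otimes> y)) = ev (delta x + delta y)"
        using xy lcs_closed N.coset_mult_FactGroup[of x y] by (simp add: ev_add ev_delta)
      then show ?thesis using ev_diff[of "delta (x \<otimes> y)" "delta x + delta y"] by (simp add: diff_diff_eq)
    qed
    moreover have "ev (delta x) = \<one>\<^bsub>?Q\<^esub>" if "x \<in> ?N" for x
      using that c_one[of x] ev_delta[of x] lcs_Suc_le by auto
    ultimately show ?thesis by (auto simp: rels_def)
  qed
  ultimately have "NN d \<subseteq> {u. ev u = \<one>\<^bsub>?Q\<^esub>}" unfolding NN_def by (rule aspan_least)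
  moreover assume "delta g \<in> NN d"
  ultimately show "g \<in> ?N" using ev_delta[OF assms] c_one[OF assms] by auto
qed (rule delta_mem_NN)

end

section \<open>Counting\<close>

text \<open>Applied to orders of kernels over all degrees below \<open>m\<close>: a gain in one
  degree gains a factor \<open>p\<close> in the product.\<close>

lemma prod_mono_strict:
  fixes f g :: "nat \<Rightarrow> nat"
  assumes "\<And>d. d < m \<Longrightarrow> f d \<le> g d" "d0 < m" "p * f d0 \<le> g d0"
  shows "p * (\<Prod>d<m. f d) \<le> (\<Prod>d<m. g d)"
proof -
  have "p * (\<Prod>d<m. f d) = (p * f d0) * (\<Prod>d\<in>{..<m} - {d0}. f d)"
    using assms(2) by (simp add: prod.remove[of "{..<m}" d0])
  also have "\<dots> \<le> g d0 * (\<Prod>d\<in>{..<m} - {d0}. g d)"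
    using assms by (intro mult_le_mono prod_mono) auto
  also have "\<dots> = (\<Prod>d<m. g d)" using assms(2) by (simp add: prod.remove[of "{..<m}" d0])
  finally show ?thesis .
qed

context finite_p_group
begin

text \<open>As \<open>LL d\<close> is infinite, its subgroups are measured by their preimages in the
  group: for \<open>NN d \<subseteq> S \<subseteq> LL d\<close> the index of \<open>NN d\<close> in
  \<open>S\<close> is \<open>card (elems d S)\<close> divided by
  \<open>card (lcs G (Suc d))\<close>.\<close>

definition elems :: "nat \<Rightarrow> ('a \<Rightarrow> int) set \<Rightarrow> 'a set" where
  "elems d S = {g \<in> lcs G d. delta g \<in> S}"

lemma subgroup_elems:
  assumes "add_sub S" "NN d \<subseteq> S"
  shows "subgroup (elems d S) G"
proof (rule subgroup.intro)
  show "elems d S \<subseteq> carrier G" using lcs_carrier by (auto simp: elems_def)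
  show "\<one> \<in> elems d S" using lcs_closed(3) delta_mem_NN[OF lcs_closed(3)] assms by (auto simp: elems_def)
  fix g assume g: "g \<in> elems d S"
  then have "delta (inv g) + delta g \<in> S" using delta_inv[of g d] assms by (auto simp: elems_def)
  then show "inv g \<in> elems d S"
    using g add_sub_add_iff'[OF assms(1)] lcs_closed by (auto simp: elems_def)
  fix h assume h: "h \<in> elems d S"
  then have "delta (g \<otimes> h) - delta g - delta h \<in> S"
    using delta_mult[of g d h] g assms by (auto simp: elems_def)
  from add_sub_add[OF assms(1) add_sub_add[OF assms(1) this, of "delta h"], of "delta g"]
  show "g \<otimes> h \<in> elems d S" using g h lcs_closed by (auto simp: elems_def)
qed

lemma finite_elems: "finite (elems d S)"
  using finite_subgroup[OF lcs_subgroup, of d] by (auto simp: elems_def)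

lemma elems_psubset:
  assumes "NN d \<subseteq> S" "add_sub S" "S \<subseteq> T" "add_sub T" "u \<in> LL d" "u \<in> T" "u \<notin> S"
  shows "elems d S \<subset> elems d T"
proof -
  obtain g where g: "g \<in> lcs G d" "u - delta g \<in> NN d" using LL_rep[OF assms(5)] by blast
  then have "delta g \<in> T" "delta g \<notin> S"
    using add_sub_diff_iff[of S u "delta g"] add_sub_diff_iff[of T u "delta g"] assms by blast+
  then show ?thesis using g assms(3) by (auto simp: elems_def)
qed

definition ker :: "('a \<Rightarrow> int) list \<Rightarrow> ('a \<Rightarrow> int) \<Rightarrow> nat \<Rightarrow> ('a \<Rightarrow> int) set" where
  "ker as x d = {l \<in> LL d. BR l x \<in> LR.A as d}"

lemma sub_ker: "add_sub (ker as x d)"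
  using sub_LL[of d] LR.sub_A[of as d] by (auto simp: ker_def add_sub_def BR_diff_left)

lemma NN_le_ker: "x \<in> LL 0 \<Longrightarrow> NN d \<subseteq> ker as x d"
proof
  fix l assume "x \<in> LL 0" "l \<in> NN d"
  then show "l \<in> ker as x d"
    using BR_NN_left[of l d x 0] NN_le_LL[of d] LR.N_le_A[of d as] by (auto simp: ker_def)
qed

lemma ker_mono: "ker as x d \<subseteq> ker (a # as) x d"
  using LR.A_mono by (auto simp: ker_def)

lemma subgroup_ker: "x \<in> LL 0 \<Longrightarrow> subgroup (elems d (ker as x d)) G"
  using subgroup_elems sub_ker NN_le_ker by blast

lemma ker_translate:
  assumes "x - y \<in> aspan {a}"
  shows "ker (a # as) x d = ker (a # as) y d"
proof -
  have "BR l x \<in> LR.A (a # as) d \<longleftrightarrow> BR l y \<in> LR.A (a # as) d" if l: "l \<in> LL d" for l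
  proof -
    have "BR l (x - y) \<in> LR.A (a # as) d"
    proof (rule aspan_additive[OF LR.sub_A BR_diff_right _ assms])
      show "BR l s \<in> LR.A (a # as) d" if "s \<in> {a}" for s
        using LR.br_mem_A[of a "a # as" l d] l that by simp
    qed
    then show ?thesis using add_sub_diff_iff[OF LR.sub_A] by (simp only: BR_diff_right)
  qed
  then show ?thesis by (auto simp: ker_def)
qed

text \<open>In logarithmic form: modulo \<open>[L, as]\<close>, the rank of \<open>l \<mapsto> [l, x]\<close> is at most
  \<open>e\<close> minus the length of \<open>as\<close>.\<close>

definition good :: "nat \<Rightarrow> nat \<Rightarrow> ('a \<Rightarrow> int) list \<Rightarrow> ('a \<Rightarrow> int) \<Rightarrow> bool" where
  "good e m as x \<longleftrightarrow> p ^ length as * (\<Prod>d<m. card (lcs G d))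
    \<le> p ^ e * (\<Prod>d<m. card (elems d (ker as x d)))"

lemma LL_trivial:
  assumes "lcs G m = {\<one>}" "m \<le> d"
  shows "LL d \<subseteq> NN d"
proof -
  have "lcs G d \<subseteq> {\<one>}" using lcs_antimono[OF assms(2)] assms(1) by simp
  then have "delta ` lcs G d \<subseteq> NN d" using delta_mem_NN[OF lcs_closed(3)] by auto
  then show ?thesis unfolding LL_def by (rule aspan_least[OF sub_NN])
qed

text \<open>The Lie ring vanishes from index \<open>m\<close> on, so products over
  \<open>d < m\<close> see every nonzero bracket.\<close>

lemma bracket_outside_bounded:
  assumes "lcs G m = {\<one>}" "l \<in> LL d" "x \<in> LL 0" "BR l x \<notin> LR.A as d"
  shows "d < m"
proof (rule ccontr)
  assume "\<not> d < m"
  then have "l \<in> NN d" using LL_trivial[OF assms(1), of d] assms(2) by auto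
  then show False using NN_le_ker[OF assms(3), of d as] assms(4) by (auto simp: ker_def)
qed

text \<open>Adding \<open>a\<close> puts \<open>l\<close> into the kernel of \<open>y\<close>, which
  therefore grows at least by the factor \<open>p\<close> in degree \<open>d\<close> and shrinks
  nowhere. Modulo \<open>a\<close> the kernels of \<open>x\<close> and \<open>y\<close>
  agree.\<close>

lemma good_Cons_step:
  assumes m: "lcs G m = {\<one>}" and x: "x \<in> LL 0" and y: "y \<in> LL 0" "good e m as y"
    and l: "l \<in> LL d" "BR l y \<in> LR.A (a # as) d" "BR l y \<notin> LR.A as d"
    and xy: "x - y \<in> aspan {a}"
  shows "good e m (a # as) x"
proof -
  have "elems d (ker as y d) \<subset> elems d (ker (a # as) y d)"
    by (rule elems_psubset[OF NN_le_ker[OF y(1)] sub_ker ker_mono sub_ker l(1)])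
      (use l in \<open>auto simp: ker_def\<close>)
  then have "p * card (elems d (ker as y d)) \<le> card (elems d (ker (a # as) y d))"
    using card_proper_subgroup subgroup_ker[OF y(1)] by blast
  moreover have "card (elems i (ker as y i)) \<le> card (elems i (ker (a # as) y i))" for i
    using subsetD[OF ker_mono] by (intro card_mono finite_elems) (auto simp: elems_def)
  ultimately have "p * (\<Prod>d<m. card (elems d (ker as y d))) \<le> (\<Prod>d<m. card (elems d (ker (a # as) y d)))"
    using bracket_outside_bounded[OF m l(1) y(1) l(3)] by (intro prod_mono_strict)
  then have "p ^ e * (p * (\<Prod>d<m. card (elems d (ker as y d))))
    \<le> p ^ e * (\<Prod>d<m. card (elems d (ker (a # as) x d)))"
    unfolding ker_translate[OF xy] by (rule mult_le_mono2)
  then have "p * (p ^ e * (\<Prod>d<m. card (elems d (ker as y d))))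
    \<le> p ^ e * (\<Prod>d<m. card (elems d (ker (a # as) x d)))"
    by (subst mult.left_commute)
  moreover have "p ^ length (a # as) * (\<Prod>d<m. card (lcs G d))
    \<le> p * (p ^ e * (\<Prod>d<m. card (elems d (ker as y d))))"
    using mult_le_mono2[OF y(2)[unfolded good_def], of p] by (simp add: mult.assoc)
  ultimately show ?thesis unfolding good_def by (rule order_trans[rotated])
qed

section \<open>Ranks in the Lie ring and centralizers in the group\<close>

text \<open>The product formula \<open>|A| |B| = |A B| |A \<inter> B|\<close> with
  \<open>A B\<close> inside \<open>S\<close>. In the injection, \<open>s\<close> chooses the left
  factor of a product depending on the product alone.\<close>

lemma card_subgroup_mult_le:
  assumes A: "subgroup A G" and B: "subgroup B G" and S: "subgroup S G" "A \<subseteq> S" "B \<subseteq> S"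
  shows "card A * card B \<le> card S * card (A \<inter> B)"
proof -
  have AG: "A \<subseteq> carrier G" "B \<subseteq> carrier G" using A B subgroup.subset by auto
  define s where "s y = (SOME a. a \<in> A \<and> inv a \<otimes> y \<in> B)" for y
  have s: "s (a \<otimes> b) \<in> A \<and> inv (s (a \<otimes> b)) \<otimes> (a \<otimes> b) \<in> B" if "a \<in> A" "b \<in> B" for a b
  proof -
    have "a \<in> A \<and> inv a \<otimes> (a \<otimes> b) \<in> B" using that AG by (auto simp: cancel_left2 subset_iff)
    then show ?thesis unfolding s_def by (rule someI)
  qed
  let ?f = "\<lambda>(a, b). (a \<otimes> b, inv (s (a \<otimes> b)) \<otimes> a)"
  have "card (A \<times> B) \<le> card (S \<times> (A \<inter> B))"
  proof (rule card_inj_on_le)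
    show "inj_on ?f (A \<times> B)"
    proof (rule inj_onI, clarify)
      fix a b a' b' assume *: "a \<in> A" "b \<in> B" "a' \<in> A" "b' \<in> B"
        "a \<otimes> b = a' \<otimes> b'" "inv (s (a \<otimes> b)) \<otimes> a = inv (s (a' \<otimes> b')) \<otimes> a'"
      have "s (a \<otimes> b) \<in> carrier G" using s[OF *(1,2)] AG by auto
      then have "a = a'" using * AG by (metis inv_closed l_cancel subsetD)
      then show "a = a' \<and> b = b'" using * AG by (metis l_cancel subsetD)
    qed
    show "?f ` (A \<times> B) \<subseteq> S \<times> (A \<inter> B)"
    proof (clarify)
      fix a b assume ab: "a \<in> A" "b \<in> B"
      note sab = s[OF ab]
      have c: "a \<in> carrier G" "b \<in> carrier G" "s (a \<otimes> b) \<in> carrier G" using ab sab AG by auto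
      have "inv (s (a \<otimes> b)) \<otimes> (a \<otimes> b) \<otimes> inv b \<in> B"
        using sab ab(2) B by (simp add: subgroup.m_closed subgroup.m_inv_closed)
      then have "inv (s (a \<otimes> b)) \<otimes> a \<in> B" using c by (simp add: m_assoc)
      moreover have "inv (s (a \<otimes> b)) \<otimes> a \<in> A"
        using sab ab(1) A by (simp add: subgroup.m_closed subgroup.m_inv_closed)
      moreover have "a \<otimes> b \<in> S" using ab S by (meson subgroup.m_closed subsetD)
      ultimately show "(a \<otimes> b \<in> S) \<and> inv (s (a \<otimes> b)) \<otimes> a \<in> A \<inter> B" by blast
    qed
    show "finite (S \<times> (A \<inter> B))" using finite_subgroup A S by auto
  qed
  then show ?thesis by (simp add: card_cartesian_product)
qed

lemma subgroup_centralizer: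
  assumes "x \<in> carrier G"
  shows "subgroup (centralizer G x) G"
proof (rule subgroup.intro)
  fix g assume g: "g \<in> centralizer G x"
  then have gx: "g \<in> carrier G" "x \<otimes> g = g \<otimes> x" by (auto simp: centralizer_def)
  have "inv g \<otimes> x = inv g \<otimes> (x \<otimes> g) \<otimes> inv g" using gx(1) assms by (simp add: word_simps)
  also have "\<dots> = x \<otimes> inv g" using gx assms by (simp add: gx(2) word_simps)
  finally show "inv g \<in> centralizer G x" using gx(1) by (simp add: centralizer_def)
  fix h assume h: "h \<in> centralizer G x"
  then have hx: "h \<in> carrier G" "h \<otimes> x = x \<otimes> h" by (auto simp: centralizer_def)
  have "g \<otimes> h \<otimes> x = g \<otimes> x \<otimes> h" using gx(1) hx assms by (simp add: m_assoc)
  also have "\<dots> = x \<otimes> (g \<otimes> h)" using gx hx(1) assms by (simp add: gx(2)[symmetric] m_assoc)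
  finally show "g \<otimes> h \<in> centralizer G x" using gx(1) hx(1) by (simp add: centralizer_def)
qed (use assms in \<open>auto simp: centralizer_def\<close>)

text \<open>The leading terms of the elements of \<open>C\<^sub>G(x)\<close> lie in the kernel of \<open>l \<mapsto> [l, x]\<close>.\<close>

lemma good_Nil_centralizer:
  assumes m: "lcs G m = {\<one>}" and x: "x \<in> carrier G" and u: "u \<in> LL 0" "u - delta x \<in> NN 0"
    and b: "card (carrier G) \<le> p ^ e * card (centralizer G x)"
  shows "good e m [] u"
proof -
  let ?C = "centralizer G x"
  let ?\<kappa> = "\<lambda>i. elems i (ker [] u i)"
  have C: "subgroup ?C G" using subgroup_centralizer[OF x] .
  have inker: "l \<in> ?\<kappa> i" if l: "l \<in> lcs G i" and c: "com G l x \<in> lcs G (Suc (Suc i))" for l i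
  proof -
    have "BR (delta l) (u - delta x) \<in> NN (Suc i)"
      using BR_NN_right[OF delta_mem_LL[OF l] u(2)] by simp
    moreover have "BR (delta l) (delta x) \<in> NN (Suc i)"
      using BR_delta lcs_carrier[OF l] x delta_mem_NN[OF c] by simp
    ultimately have "BR (delta l) u \<in> NN (Suc i)"
      using add_sub_diff_iff[OF sub_NN] by (metis BR_diff_right)
    then show ?thesis using l delta_mem_LL by (simp add: elems_def ker_def)
  qed
  have step: "card (?C \<inter> lcs G i) * card (lcs G (Suc i)) \<le> card (?\<kappa> i) * card (?C \<inter> lcs G (Suc i))" for i
  proof -
    have "subgroup (?C \<inter> lcs G i) G" using C lcs_subgroup by (rule subgroups_Inter_pair)
    moreover have "?C \<inter> lcs G i \<subseteq> ?\<kappa> i"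
    proof
      fix l assume l: "l \<in> ?C \<inter> lcs G i"
      then have "com G l x = \<one>" using com_eq_one_iff x by (auto simp: centralizer_def)
      then show "l \<in> ?\<kappa> i" using inker[of l i] l lcs_closed(3) by simp
    qed
    moreover have "lcs G (Suc i) \<subseteq> ?\<kappa> i"
      using inker lcs_Suc_le com_mem_lcs_Suc x by blast
    moreover have "(?C \<inter> lcs G i) \<inter> lcs G (Suc i) = ?C \<inter> lcs G (Suc i)" using lcs_Suc_le by blast
    ultimately show ?thesis
      using card_subgroup_mult_le[OF _ lcs_subgroup subgroup_ker[OF u(1)]] by metis
  qed
  \<comment> \<open>Multiplying \<open>step\<close> over \<open>i < k\<close> telescopes: the orders
    of \<open>?C \<inter> lcs G i\<close> go from \<open>card ?C\<close> down to 1 at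
    \<open>k = m\<close>.\<close>
  have "card ?C * (\<Prod>i<k. card (lcs G (Suc i))) \<le> (\<Prod>i<k. card (?\<kappa> i)) * card (?C \<inter> lcs G k)" for k
  proof (induction k)
    case 0
    have "?C \<inter> lcs G 0 = ?C" using subgroup.subset[OF C] by auto
    then show ?case by simp
  next
    case (Suc k)
    have "card ?C * (\<Prod>i<Suc k. card (lcs G (Suc i)))
      \<le> (\<Prod>i<k. card (?\<kappa> i)) * (card (?C \<inter> lcs G k) * card (lcs G (Suc k)))"
      using mult_le_mono1[OF Suc, of "card (lcs G (Suc k))"] by (simp add: mult.assoc)
    also have "\<dots> \<le> (\<Prod>i<k. card (?\<kappa> i)) * (card (?\<kappa> k) * card (?C \<inter> lcs G (Suc k)))"
      using step by (rule mult_le_mono2)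
    finally show ?case by (simp add: mult.assoc)
  qed
  from this[of m] have "card ?C * (\<Prod>i<m. card (lcs G (Suc i))) \<le> (\<Prod>i<m. card (?\<kappa> i))"
    using m subgroup.one_closed[OF C] by simp
  then have "card (carrier G) * (card ?C * (\<Prod>i<m. card (lcs G (Suc i))))
    \<le> p ^ e * card ?C * (\<Prod>i<m. card (?\<kappa> i))"
    using b by (rule mult_le_mono[rotated])
  moreover have "(\<Prod>i<m. card (lcs G i)) = card (carrier G) * (\<Prod>i<m. card (lcs G (Suc i)))"
    using prod.lessThan_Suc_shift[of "\<lambda>i. card (lcs G i)" m] m by simp
  ultimately have "card ?C * (\<Prod>i<m. card (lcs G i)) \<le> card ?C * (p ^ e * (\<Prod>i<m. card (?\<kappa> i)))"
    by (simp add: ac_simps)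
  then show ?thesis using card_subgroup_pos[OF C] by (simp add: good_def)
qed

text \<open>The letter \<open>a\<close> enlarges \<open>A as d\<close> at most by the index of the
  kernel of \<open>l \<mapsto> [l, a]\<close>. An element \<open>q\<close> of the larger group is a
  commutator \<open>com G (s q) x\<close> up to an element of \<open>?P\<close>, where
  \<open>x\<close> represents \<open>a\<close>.\<close>

lemma card_A_Cons:
  assumes as: "set as \<subseteq> LL 0" and a: "a \<in> LL 0"
  shows "card (elems (Suc d) (LR.A (a # as) d)) * card (elems d (ker as a d))
    \<le> card (elems (Suc d) (LR.A as d)) * card (lcs G d)"
proof -
  let ?Q = "elems (Suc d) (LR.A (a # as) d)" and ?P = "elems (Suc d) (LR.A as d)"
  let ?K = "elems d (ker as a d)"
  obtain x where x: "x \<in> carrier G" "a - delta x \<in> NN 0" using LL_rep[OF a] by auto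
  have sub: "add_sub (LR.A as d)" by (rule LR.sub_A)
  have NA: "NN (Suc d) \<subseteq> LR.A as d" by (rule LR.N_le_A)
  have br: "BR (delta l) a \<in> LR.A as d \<longleftrightarrow> delta (com G l x) \<in> LR.A as d"
    "BR (delta l) a - delta (com G l x) \<in> LR.A as d" if l: "l \<in> lcs G d" for l
  proof -
    have "BR (delta l) (a - delta x) \<in> NN (Suc d)"
      using BR_NN_right[OF delta_mem_LL[OF l] x(2)] by simp
    then show "BR (delta l) a - delta (com G l x) \<in> LR.A as d"
      using NA BR_delta[OF lcs_carrier[OF l] x(1)] by (auto simp: BR_diff_right)
    then show "BR (delta l) a \<in> LR.A as d \<longleftrightarrow> delta (com G l x) \<in> LR.A as d"
      using add_sub_diff_iff[OF sub] by blast
  qed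
  have cx: "com G l x \<in> lcs G (Suc d)" if "l \<in> lcs G d" for l using com_mem_lcs_Suc that x by blast
  have "\<exists>l\<in>lcs G d. q \<otimes> inv (com G l x) \<in> ?P" if q: "q \<in> ?Q" for q
  proof -
    obtain z v where z: "delta q = z + BR v a" "z \<in> LR.A as d" "v \<in> LL d"
      using q by (auto simp: elems_def LR.A.simps(2))
    obtain l where l: "l \<in> lcs G d" "v - delta l \<in> NN d" using LL_rep[OF z(3)] by blast
    have "BR (v - delta l) a \<in> LR.A as d" using BR_NN_left[OF l(2) a] NA by auto
    then have 1: "BR v a - BR (delta l) a \<in> LR.A as d" by (simp add: BR_diff_left)
    have qd: "q \<in> lcs G (Suc d)" using q by (simp add: elems_def)
    have 2: "delta q - delta (com G l x) - delta (q \<otimes> inv (com G l x)) \<in> LR.A as d"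
      using delta_div[OF qd cx[OF l(1)]] NA by blast
    have "z + (BR v a - BR (delta l) a) + (BR (delta l) a - delta (com G l x))
      - (delta q - delta (com G l x) - delta (q \<otimes> inv (com G l x))) \<in> LR.A as d"
      by (intro add_sub_diff[OF sub] add_sub_add[OF sub] z(2) 1 2 br(2) l(1))
    then have "delta (q \<otimes> inv (com G l x)) \<in> LR.A as d" by (simp add: z(1) algebra_simps)
    moreover have "q \<otimes> inv (com G l x) \<in> lcs G (Suc d)"
      by (rule lcs_closed(1)[OF qd lcs_closed(2)[OF cx[OF l(1)]]])
    ultimately show ?thesis using l(1) by (auto simp: elems_def)
  qed
  then obtain s where s: "\<And>q. q \<in> ?Q \<Longrightarrow> s q \<in> lcs G d \<and> q \<otimes> inv (com G (s q) x) \<in> ?P" by metis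
  have P: "subgroup ?P G" using subgroup_elems[OF sub NA] .
  have K: "k \<in> lcs G d" "com G k x \<in> ?P" if "k \<in> ?K" for k
    using that br(1)[of k] cx by (auto simp: elems_def ker_def)
  \<comment> \<open>The second entry determines the commutator in the first one, hence
    \<open>q\<close>, and then also \<open>k\<close>.\<close>
  let ?f = "\<lambda>(q, k). (q \<otimes> inv (com G (s q \<otimes> k) x), s q \<otimes> k)"
  have "card (?Q \<times> ?K) \<le> card (?P \<times> lcs G d)"
  proof (rule card_inj_on_le)
    show "inj_on ?f (?Q \<times> ?K)"
    proof (rule inj_onI, clarify)
      fix q k q' k' assume *: "q \<in> ?Q" "k \<in> ?K" "q' \<in> ?Q" "k' \<in> ?K"
        "q \<otimes> inv (com G (s q \<otimes> k) x) = q' \<otimes> inv (com G (s q' \<otimes> k') x)" "s q \<otimes> k = s q' \<otimes> k'"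
      have c: "q \<in> carrier G" "q' \<in> carrier G" "s q \<in> carrier G" "k \<in> carrier G" "k' \<in> carrier G"
        using *(1,3) conjunct1[OF s[OF *(1)]] K(1)[OF *(2)] K(1)[OF *(4)]
        by (auto simp: elems_def dest: lcs_carrier)
      have w: "inv (com G (s q \<otimes> k) x) \<in> carrier G" using c x(1) by simp
      then have "q = q'" using *(5)[folded *(6)] c by (simp only: r_cancel)
      then show "q = q' \<and> k = k'" using *(6) c by simp
    qed
    show "?f ` (?Q \<times> ?K) \<subseteq> ?P \<times> lcs G d"
    proof (clarify)
      fix q k assume q: "q \<in> ?Q" and k: "k \<in> ?K"
      have sq: "s q \<in> lcs G d" "q \<otimes> inv (com G (s q) x) \<in> ?P" using s[OF q] by auto
      have qd: "q \<in> lcs G (Suc d)" using q by (simp add: elems_def)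
      note kP = K[OF k]
      have c: "q \<in> carrier G" "s q \<in> carrier G" "k \<in> carrier G"
        using qd sq kP lcs_carrier by auto
      let ?c = "com G (s q) (com G k x)"
      have "?c \<in> lcs G (Suc (Suc d))"
        by (rule com_swap_mem[OF lcs_subgroup _ _ com_mem_lcs_Suc[OF cx[OF kP(1)] c(2)]]) (use c x in simp_all)
      then have "?c \<in> ?P" using delta_mem_NN[of ?c "Suc d"] NA lcs_Suc_le by (auto simp: elems_def)
      then have "q \<otimes> inv (com G (s q) x) \<otimes> inv (com G k x) \<otimes> inv ?c \<in> ?P"
        using sq(2) kP(2) P by (simp add: subgroup.m_closed subgroup.m_inv_closed)
      moreover have "q \<otimes> inv (com G (s q) x) \<otimes> inv (com G k x) \<otimes> inv ?c
        = q \<otimes> inv (com G (s q \<otimes> k) x)"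
        using c x(1) by (simp add: com_mult_left inv_mult_group m_assoc)
      ultimately show "q \<otimes> inv (com G (s q \<otimes> k) x) \<in> ?P \<and> s q \<otimes> k \<in> lcs G d"
        using sq kP lcs_closed by simp
    qed
    show "finite (?P \<times> lcs G d)" using finite_subgroup P lcs_subgroup by blast
  qed
  then show ?thesis by (simp add: card_cartesian_product)
qed

text \<open>By the pigeonhole principle, two of the elements \<open>z \<otimes> x [^] t\<close> with
  \<open>t < p\<close> would lie in the same \<open>H i\<close>, and so would \<open>x [^] r\<close>
  with \<open>0 < r < p\<close>. As \<open>r\<close> is prime to \<open>p\<close>, \<open>x\<close>
  is a power of it.\<close>

lemma coset_avoiding:
  assumes I: "finite I" "card I < p" and H: "\<And>i. i \<in> I \<Longrightarrow> subgroup (H i) G"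
    and x: "x \<in> carrier G" "\<And>i. i \<in> I \<Longrightarrow> x \<notin> H i" and z: "z \<in> carrier G"
  shows "\<exists>t::nat. \<forall>i\<in>I. z \<otimes> x [^] t \<notin> H i"
proof (rule ccontr)
  assume "\<not> ?thesis"
  then obtain f where f: "\<And>t::nat. f t \<in> I \<and> z \<otimes> x [^] t \<in> H (f t)" by metis
  have "\<not> inj_on f {..<p}"
    using card_inj_on_le[of f "{..<p}" I] f I by auto
  then obtain t t' where t: "t < p" "t' < p" "t < t'" "f t = f t'"
    unfolding inj_on_def by (metis lessThan_iff linorder_neqE_nat)
  define r where "r = t' - t"
  have r: "0 < r" "r < p" "t' = t + r" using t by (auto simp: r_def)
  let ?H = "H (f t)"
  interpret Hs: subgroup ?H G using H f by blast
  have "z \<otimes> x [^] t \<in> ?H" "z \<otimes> x [^] t' \<in> ?H" using f t(4) by metis+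
  then have "inv (z \<otimes> x [^] t) \<otimes> (z \<otimes> x [^] t') \<in> ?H" using Hs.m_closed Hs.m_inv_closed by blast
  moreover have "inv (z \<otimes> x [^] t) \<otimes> (z \<otimes> x [^] t') = x [^] r"
    using z x(1) r(3) by (simp add: nat_pow_mult[symmetric] word_simps)
  ultimately have xr: "x [^] r \<in> ?H" by simp
  obtain k where k: "order G = p ^ k" using order_power by blast
  have "\<not> p dvd r" using r by (auto dest: dvd_imp_le)
  then have "gcd r (p ^ k) = 1"
    using prime by (metis coprime_commute coprime_iff_gcd_eq_1 coprime_power_right_iff prime_imp_coprime)
  then obtain u v where uv: "r * u = p ^ k * v + 1"
    using bezout_nat[of r "p ^ k"] r(1) by auto
  have "(x [^] r) [^] u \<in> ?H" using xr by (induction u) auto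
  then have "x [^] (p ^ k * v + 1) \<in> ?H" using x(1) by (simp add: nat_pow_pow uv)
  moreover have "x [^] (p ^ k * v + 1) = x"
  proof -
    have "x [^] (p ^ k) = \<one>" using pow_order_eq_1[OF x(1)] k by simp
    then have "x [^] (p ^ k * v) = \<one>" using x(1) by (simp flip: nat_pow_pow)
    then show ?thesis using x(1) by (simp add: nat_pow_mult[symmetric])
  qed
  ultimately show False using x(2) f by auto
qed

text \<open>\<open>U_not_le\<close> comes from \<open>subgroups_not_cover\<close>,
  \<open>U_translate\<close> from \<open>coset_avoiding\<close>, and goodness at the start from the
  centralizer bound.\<close>

lemma good_elements_interp:
  assumes m: "lcs G m = {\<one>}" and I: "finite I" "card I < p"
    and H: "\<And>i. i \<in> I \<Longrightarrow> subgroup (H i) G \<and> H i \<noteq> carrier G"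
    and b: "\<And>x. x \<in> carrier G \<Longrightarrow> (\<forall>i\<in>I. x \<notin> H i) \<Longrightarrow>
      card (carrier G) \<le> p ^ e * card (centralizer G x)"
  shows "good_elements LL NN BR (good e m)
    {u \<in> LL 0. \<exists>x\<in>carrier G. (\<forall>i\<in>I. x \<notin> H i) \<and> u - delta x \<in> NN 0}"
proof (unfold_locales)
  let ?U = "{u \<in> LL 0. \<exists>x\<in>carrier G. (\<forall>i\<in>I. x \<notin> H i) \<and> u - delta x \<in> NN 0}"
  show "?U \<subseteq> LL 0" by blast
  show "good e m [] x" if "x \<in> ?U" for x
    using that good_Nil_centralizer[OF m] b by blast
  show "\<exists>x\<in>?U. x \<notin> K" if K: "add_sub K" "NN 0 \<subseteq> K" "\<exists>x\<in>LL 0. x \<notin> K" for K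
  proof -
    obtain v where v: "v \<in> LL 0" "v \<notin> K" using K(3) by blast
    have "add_sub (K \<inter> LL 0)" using K(1) sub_LL[of 0] by (auto simp: add_sub_def)
    then have "elems 0 (K \<inter> LL 0) \<subset> elems 0 (LL 0)"
      by (intro elems_psubset[OF _ _ _ sub_LL v(1)]) (use v K(2) NN_le_LL in auto)
    moreover have "elems 0 (K \<inter> LL 0) = elems 0 K" using delta_mem_LL by (auto simp: elems_def)
    ultimately have proper: "elems 0 K \<noteq> carrier G" by (auto simp: elems_def)
    \<comment> \<open>The index \<open>None\<close> adds the subgroup belonging to \<open>K\<close>,
      so there may be \<open>p\<close> subgroups.\<close>
    define H' where "H' j = (case j of None \<Rightarrow> elems 0 K | Some i \<Rightarrow> H i)" for j
    have "\<exists>x\<in>carrier G. \<forall>j\<in>insert None (Some ` I). x \<notin> H' j"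
    proof (rule subgroups_not_cover)
      show "finite (insert None (Some ` I))" using I by simp
      show "card (insert None (Some ` I)) \<le> p"
        using I by (simp add: card_insert_if card_image)
      show "subgroup (H' j) G \<and> H' j \<noteq> carrier G" if "j \<in> insert None (Some ` I)" for j
        using that H subgroup_elems[OF K(1,2)] proper by (auto simp: H'_def)
    qed
    then obtain x where x: "x \<in> carrier G" "\<forall>i\<in>I. x \<notin> H i" "x \<notin> elems 0 K"
      by (auto simp: H'_def)
    have "delta x - delta x \<in> NN 0" unfolding diff_self by (rule add_sub_zero[OF sub_NN])
    moreover have "delta x \<in> LL 0" using x(1) by (intro delta_mem_LL) simp
    ultimately have "delta x \<in> ?U" using x by blast
    then show ?thesis using x by (auto simp: elems_def)
  qed
  show "\<exists>y\<in>?U. v - y \<in> aspan {a}" if a: "a \<in> ?U" and v: "v \<in> LL 0" for a v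
  proof -
    obtain x where x: "a \<in> LL 0" "x \<in> carrier G" "\<And>i. i \<in> I \<Longrightarrow> x \<notin> H i" "a - delta x \<in> NN 0"
      using a by blast
    obtain z where z: "z \<in> carrier G" "v - delta z \<in> NN 0" using LL_rep[OF v] by auto
    obtain t :: nat where t: "\<forall>i\<in>I. z \<otimes> x [^] t \<notin> H i"
      using coset_avoiding[where H = H, OF I conjunct1[OF H] x(2,3) z(1)] by blast
    have "\<exists>y. y \<in> LL 0 \<and> v - y \<in> aspan {a} \<and> y - delta (z \<otimes> x [^] k) \<in> NN 0" for k :: nat
    proof (induction k)
      case 0
      have "v - v \<in> aspan {a}" unfolding diff_self by (rule aspan.zero)
      moreover have "z \<otimes> x [^] (0 :: nat) = z" using z(1) by simp
      ultimately show ?case using v z(2) by metis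
    next
      case (Suc k)
      then obtain y where y: "y \<in> LL 0" "v - y \<in> aspan {a}" "y - delta (z \<otimes> x [^] k) \<in> NN 0" by blast
      have "z \<otimes> x [^] k \<in> lcs G 0" "x \<in> lcs G 0" using z x by simp_all
      then have "(y - delta (z \<otimes> x [^] k)) + (a - delta x)
        - (delta (z \<otimes> x [^] k \<otimes> x) - delta (z \<otimes> x [^] k) - delta x) \<in> NN 0"
        by (intro add_sub_add[OF sub_NN] add_sub_diff[OF sub_NN] y x delta_mult)
      then have "(y + a) - delta (z \<otimes> x [^] Suc k) \<in> NN 0"
        using z x by (simp add: algebra_simps m_assoc)
      moreover have "v - (y + a) \<in> aspan {a}"
        using aspan.diff[OF y(2) aspan.base[of a "{a}"]] by (simp add: diff_diff_eq)
      ultimately show ?case using add_sub_add[OF sub_LL y(1) x(1)] by blast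
    qed
    from this[of t] obtain y where "y \<in> LL 0" "v - y \<in> aspan {a}" "y - delta (z \<otimes> x [^] t) \<in> NN 0" by blast
    moreover have "z \<otimes> x [^] t \<in> carrier G" using z(1) x(2) by simp
    ultimately show ?thesis using t by blast
  qed
  show "good e m (a # as) x"
    if "x \<in> LL 0" "y \<in> LL 0" "good e m as y" "l \<in> LL d" "BR l y \<in> LR.A (a # as) d"
      "BR l y \<notin> LR.A as d" "x - y \<in> aspan {a}" for as a x y l d
    using good_Cons_step[OF m] that by blast
qed

section \<open>The bound for the derived subgroup\<close>

text \<open>Up to the factor \<open>vol m []\<close>, this is the product over the degrees of the
  orders of \<open>A as d\<close> modulo \<open>NN (Suc d)\<close>.\<close>

definition vol :: "nat \<Rightarrow> ('a \<Rightarrow> int) list \<Rightarrow> nat" where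
  "vol m as = (\<Prod>d<m. card (elems (Suc d) (LR.A as d)))"

text \<open>The factors for \<open>as\<close> and for \<open>[]\<close> are consecutive terms of the
  lower central series, so the two products differ only by the order of
  \<open>lcs G 1\<close>.\<close>

lemma vol_full:
  assumes m: "lcs G m = {\<one>}" and full: "\<And>d. LR.A as d = LL (Suc d)"
  shows "vol m as = card (lcs G 1) * vol m []"
proof -
  have 1: "elems (Suc d) (LR.A as d) = lcs G (Suc d)" for d
    using delta_mem_LL by (auto simp: elems_def full)
  have 2: "elems (Suc d) (NN (Suc d)) = lcs G (Suc (Suc d))" for d
    using delta_mem_NN_iff lcs_Suc_le by (auto simp: elems_def)
  have "lcs G (Suc m) = {\<one>}" using lcs_Suc_le[of m] m lcs_closed(3)[of "Suc m"] by auto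
  then show ?thesis
    using prod.lessThan_Suc_shift[of "\<lambda>i. card (lcs G (Suc i))" m] by (simp add: vol_def 1 2)
qed

text \<open>The new letter multiplies the volume at most by the product of the indices of its
  kernels, which \<open>good\<close> bounds by \<open>p ^ (e - length as)\<close>. The bracket
  outside \<open>A as d\<close> makes this product at least \<open>p\<close>, so
  \<open>length as\<close> is below \<open>e\<close>.\<close>

lemma vol_Cons:
  assumes m: "lcs G m = {\<one>}" and as: "set as \<subseteq> LL 0" and a: "a \<in> LL 0" "good e m as a"
    and l: "l \<in> LL d" "BR l a \<notin> LR.A as d"
  shows "length as < e" "vol m (a # as) \<le> p ^ (e - length as) * vol m as"
proof -
  let ?K = "\<Prod>d<m. card (elems d (ker as a d))" and ?L = "\<Prod>d<m. card (lcs G d)"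
  have K: "?K > 0" using card_subgroup_pos[OF subgroup_ker[OF a(1)]] by (simp add: prod_pos)
  have le: "p ^ length as * ?L \<le> p ^ e * ?K" using a(2) by (simp add: good_def)
  have "elems d (ker as a d) \<subset> elems d (LL d)"
    by (rule elems_psubset[OF NN_le_ker[OF a(1)] sub_ker _ sub_LL l(1) l(1)])
      (use l in \<open>auto simp: ker_def\<close>)
  also have "elems d (LL d) = lcs G d" using delta_mem_LL by (auto simp: elems_def)
  finally have "p * card (elems d (ker as a d)) \<le> card (lcs G d)"
    using card_proper_subgroup subgroup_ker[OF a(1)] lcs_subgroup by blast
  moreover have "card (elems i (ker as a i)) \<le> card (lcs G i)" for i
    by (intro card_mono finite_subgroup lcs_subgroup) (auto simp: elems_def)
  ultimately have "p * ?K \<le> ?L"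
    using bracket_outside_bounded[OF m l(1) a(1) l(2)] by (intro prod_mono_strict)
  then have "p ^ length as * (p * ?K) \<le> p ^ e * ?K"
    using le by (meson le_trans mult_le_mono2)
  then have "p ^ Suc (length as) \<le> p ^ e" using K by (simp add: mult.assoc[symmetric] mult.commute)
  then show len: "length as < e" using p_gt_1 by (metis Suc_le_eq power_increasing_iff)
  have "vol m (a # as) * ?K \<le> vol m as * ?L"
    unfolding vol_def prod.distrib[symmetric] using card_A_Cons[OF as a(1)] by (intro prod_mono) auto
  then have "p ^ length as * (vol m (a # as) * ?K) \<le> vol m as * (p ^ length as * ?L)"
    by (metis mult.left_commute mult_le_mono2)
  also have "\<dots> \<le> vol m as * (p ^ e * ?K)" using le by (rule mult_le_mono2)
  also have "p ^ e = p ^ length as * p ^ (e - length as)" using len by (simp flip: power_add)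
  finally have "(p ^ length as * ?K) * vol m (a # as) \<le> (p ^ length as * ?K) * (p ^ (e - length as) * vol m as)"
    by (simp add: ac_simps)
  then show "vol m (a # as) \<le> p ^ (e - length as) * vol m as" using K p_gt_1 by simp
qed

lemma triangular_Suc: "Suc k * (Suc k - 1) div 2 = k * (k - 1) div 2 + k"
proof -
  have "Suc k * k = k * (k - 1) + 2 * k" by (cases k) auto
  then show ?thesis by simp
qed

text \<open>Successive letters contribute the exponents \<open>e, e - 1, ..., 1\<close> at most, and
  the construction stops only when \<open>A as\<close> is everything.\<close>

theorem card_derived_bound:
  assumes I: "finite I" "card I < p"
    and H: "\<And>i. i \<in> I \<Longrightarrow> subgroup (H i) G \<and> H i \<noteq> carrier G"
    and b: "\<And>x. x \<in> carrier G \<Longrightarrow> (\<forall>i\<in>I. x \<notin> H i) \<Longrightarrow>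
      card (carrier G) \<le> p ^ e * card (centralizer G x)"
  shows "card (lcs G 1) \<le> p ^ (Suc e * e div 2)"
proof -
  obtain m where m: "lcs G m = {\<one>}" using lcs_trivial by blast
  interpret E: good_elements LL NN BR "good e m"
    "{u \<in> LL 0. \<exists>x\<in>carrier G. (\<forall>i\<in>I. x \<notin> H i) \<and> u - delta x \<in> NN 0}"
    by (rule good_elements_interp[OF m I H b])
  define T where "T k = k * (k - 1) div 2" for k :: nat
  have T_Suc: "T (Suc k) = T k + k" for k using triangular_Suc by (simp add: T_def)
  have vol_pos: "vol m [] > 0"
    unfolding vol_def using card_subgroup_pos[OF subgroup_elems[OF sub_NN order_refl]]
    by (simp add: prod_pos)
  \<comment> \<open>The exponents still available after the letters \<open>as\<close> sum to
    \<open>T (Suc e - length as)\<close>.\<close>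
  have "card (lcs G 1) * vol m [] \<le> p ^ T (Suc e) * vol m []"
    if "as = [] \<or> E.extendible as" "length as \<le> e" "vol m as * p ^ T (Suc e - length as) \<le> p ^ T (Suc e) * vol m []"
    for as
    using that
  proof (induction "e - length as" arbitrary: as rule: less_induct)
    case less
    have as: "set as \<subseteq> LL 0" using less.prems(1) by (auto simp: E.extendible_def)
    show ?case
    proof (cases "\<forall>d. LR.A as d = LL (Suc d)")
      case True
      then have "card (lcs G 1) * vol m [] = vol m as" using vol_full[OF m] by simp
      also have "\<dots> \<le> vol m as * p ^ T (Suc e - length as)" using p_gt_1 by simp
      also note less.prems(3)
      finally show ?thesis .
    next
      case False
      have "\<exists>a\<in>LL 0. good e m as a \<and> E.extendible (a # as) \<and> (\<exists>d. \<exists>l\<in>LL d. BR l a \<notin> LR.A as d)"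
      proof (cases "as = []")
        case True
        \<comment> \<open>If all brackets of degree two vanished, \<open>L_spanned_by_words\<close>
          without letters would make \<open>A []\<close> everything.\<close>
        have "\<not> LR.exhausted []"
        proof
          assume ex: "LR.exhausted []"
          have "LL (Suc d) \<subseteq> LR.A [] d" for d
            by (rule conjunct2[OF LR.L_spanned_by_words])
              (use ex in \<open>auto simp: LR.exhausted_def\<close>)
          then show False using \<open>\<not> (\<forall>d. LR.A as d = LL (Suc d))\<close> LR.A_le_L[OF as] True by blast
        qed
        then show ?thesis using E.extendible_singleton True by simp
      next
        case False
        then show ?thesis
          using E.extendible_extension less.prems(1) \<open>\<not> (\<forall>d. LR.A as d = LL (Suc d))\<close> by blast
      qed
      then obtain a d l where a: "a \<in> LL 0" "good e m as a" "E.extendible (a # as)"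
        "l \<in> LL d" "BR l a \<notin> LR.A as d" by blast
      note v = vol_Cons[OF m as a(1,2,4,5)]
      have eq: "Suc e - length as = Suc (e - length as)" using v(1) by simp
      have "vol m (a # as) * p ^ T (e - length as)
        \<le> (p ^ (e - length as) * vol m as) * p ^ T (e - length as)"
        using v(2) by (rule mult_le_mono1)
      also have "\<dots> = vol m as * p ^ T (Suc e - length as)"
        by (simp add: eq T_Suc power_add)
      also have "\<dots> \<le> p ^ T (Suc e) * vol m []" by (rule less.prems(3))
      finally show ?thesis
        using less.hyps[of "a # as"] a(3) v(1) by simp
    qed
  qed
  from this[of "[]"] have "card (lcs G 1) \<le> p ^ T (Suc e)" using vol_pos by simp
  then show ?thesis by (simp add: T_def)
qed

lemma card_eq_breadth:
  assumes "x \<in> carrier G"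
  shows "card (carrier G) = p ^ breadth G p x * card (centralizer G x)"
proof -
  let ?C = "centralizer G x"
  have C: "subgroup ?C G" using subgroup_centralizer[OF assms] .
  have lag: "card (rcosets ?C) * card ?C = order G" using lagrange[OF C] .
  then obtain b where b: "card (rcosets ?C) = p ^ b"
    using order_power prime divides_primepow_nat by (metis dvd_triv_left)
  then have "breadth G p x = b"
    unfolding breadth_def using p_gt_1 by (intro the_equality) (auto simp: power_inject_exp)
  then show ?thesis using b lag by (simp add: order_def)
qed

end

theorem theorem2p2:
  fixes G :: "('a, 'b) monoid_scheme" and p n :: nat
  assumes "Factorial_Ring.prime p"
    and "p_group G p"
    and "card (derived G (carrier G)) > p ^ (n * (n - 1) div 2)"
  shows "\<not> (\<exists>H :: nat \<Rightarrow> 'a set.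
            (\<forall>i \<in> {1..p - 1}. subgroup (H i) G \<and> H i \<noteq> carrier G) \<and>
            {x \<in> carrier G. breadth G p x \<ge> n} \<subseteq> (\<Union>i \<in> {1..p - 1}. H i))"
proof
  assume "\<exists>H :: nat \<Rightarrow> 'a set. (\<forall>i \<in> {1..p - 1}. subgroup (H i) G \<and> H i \<noteq> carrier G) \<and>
            {x \<in> carrier G. breadth G p x \<ge> n} \<subseteq> (\<Union>i \<in> {1..p - 1}. H i)"
  then obtain H :: "nat \<Rightarrow> 'a set"
    where H: "\<And>i. i \<in> {1..p - 1} \<Longrightarrow> subgroup (H i) G \<and> H i \<noteq> carrier G"
      and cov: "{x \<in> carrier G. breadth G p x \<ge> n} \<subseteq> (\<Union>i \<in> {1..p - 1}. H i)" by blast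
  interpret finite_p_group G p
    using assms(1,2) unfolding p_group_def finite_p_group_def finite_p_group_axioms_def by blast
  have low: "breadth G p x < n" if "x \<in> carrier G" "\<forall>i\<in>{1..p - 1}. x \<notin> H i" for x
    using that cov by fastforce
  show False
  proof (cases n)
    \<comment> \<open>No breadth is below 0, so the subgroups would cover the whole group.\<close>
    case 0
    then show ?thesis using subgroups_not_cover[of "{1..p - 1}" H] H low by auto
  next
    \<comment> \<open>A breadth below \<open>n\<close> is at most \<open>e = n - 1\<close>, so
      \<open>Suc e * e div 2\<close> is the exponent in the hypothesis.\<close>
    case (Suc e)
    have "card (lcs G 1) \<le> p ^ (Suc e * e div 2)"
    proof (rule card_derived_bound[of "{1..p - 1}" H])
      fix x assume x: "x \<in> carrier G" "\<forall>i\<in>{1..p - 1}. x \<notin> H i"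
      have "p ^ breadth G p x \<le> p ^ e"
        using low[OF x] Suc p_gt_1 by (intro power_increasing) auto
      then show "card (carrier G) \<le> p ^ e * card (centralizer G x)"
        using card_eq_breadth[OF x(1)] by simp
    qed (use H p_gt_1 in auto)
    then show ?thesis using assms(3) Suc derived_eq_lcs[of G] by simp
  qed
qed

end
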